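(* Let $H$ be a linear hyperplane of $V$ with $H\cap\operatorname{conv}(E)=\varnothing$, and let $H^+$ be an open half-space bounded by $H$ that does not meet $\operatorname{conv}(E)$. Then there is $w\in W$ such that $\Phi^+\cap H^+=N(w)$. Moreover, any finite biclosed set is obtained in this way: for every finite biclosed $A\subseteq\Phi^+$ there exist a linear hyperplane $H$ of $V$ with $H\cap\operatorname{conv}(E)=\varnothing$ and an open half-space $H^+$ bounded by $H$ with $H^+\cap\operatorname{conv}(E)=\varnothing$ such that $A=\Phi^+\cap H^+$.
   Context: Setting. $V$ is a finite-dimensional real vector space with a symmetric bilinear form $B$. For $\alpha\in V$ with $B(\alpha,\alpha)\neq 0$, let $s_\alpha(v)=v-2\frac{B(\alpha,v)}{B(\alpha,\alpha)}\alpha$. For $A\subseteq V$, $\operatorname{cone}(A)$ is the set of finite non-negative linear combinations of elements of $A$, and $\operatorname{conv}$ denotes convex hull. $(W,S)$ is a Coxeter system with $S$ finite, given with a geometric representation: $W\subseteq O_B(V)$ and each $s\in S$ equals $s_{\alpha_s}$, where $\Delta=\{\alpha_s\mid s\in S\}$ is a simple system, i.e. (1) $\Delta$ is positively linearly independent: if $\sum_{\alpha\in\Delta}a_\alpha\alpha=0$ with all $a_\alpha\ge 0$, then all $a_\alpha=0$; (2) for distinct $\alpha,\beta\in\Delta$, $B(\alpha,\beta)\in\,]-\infty,-1]\cup\{-\cos(\pi/k)\mid k\in\mathbb{Z}_{\ge 2}\}$; (3) $B(\alpha,\alpha)=1$ for all $\alpha\in\Delta$. ($B(\alpha_s,\alpha_t)=-\cos(\pi/m)$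 if $st$ has finite order $m$, and $B(\alpha_s,\alpha_t)\le -1$ if $st$ has infinite order.) The root system is $\Phi=W(\Delta)$, the positive roots are $\Phi^+=\operatorname{cone}(\Delta)\cap\Phi$, and $\Phi^-=-\Phi^+$; one has $\Phi=\Phi^+\sqcup\Phi^-$. For $w\in W$, the inversion set is $N(w)=\Phi^+\cap w(\Phi^-)$. A subset $A\subseteq\Phi^+$ is closed if $\operatorname{cone}(\{\alpha,\beta\})\cap\Phi\subseteq A$ for all $\alpha,\beta\in A$; it is biclosed if both $A$ and $\Phi^+\setminus A$ are closed. Normalized roots and limit roots. Fix an affine hyperplane $V_1$ of $V$ transverse to $\Phi^+$: for every $\beta\in\Phi^+$ the ray $\mathbb{R}^+\beta$ meets $V_1$ in a unique nonzero point $\widehat\beta$; put $\widehat{-\beta}=\widehat\beta$. Let $\widehat\Phi=\{\widehat\beta\mid\beta\in\Phi\}$. $E\subseteq V_1$ is the set of accumulation points of $\widehat\Phi$ (the set of limit roots; $E=\varnothing$ if $W$ is finite), and $\operatorname{conv}(E)$ is the imaginary convex body. *)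

theory Defs
  imports "HOL-Analysis.Analysis" "HOL-Algebra.Multiplicative_Group"
begin

section \<open>Coxeter systems\<close>

text \<open>
  One rewriting step between words over the generators: delete a factor
  \<open>s t s t \<dots> s t\<close> (\<open>m\<close> copies of \<open>s t\<close>), where \<open>m\<close> is the order of \<open>s t\<close> in \<open>G\<close>.
  \<open>group.ord\<close> is \<open>0\<close> exactly when the order is infinite. The case \<open>s = t\<close> has
  \<open>m = 1\<close> when \<open>s\<close> is an involution and gives the relation \<open>s s = 1\<close>; hence the monoid
  presented by these relations is already the group presented by them, and no formal inverses
  of the generators are needed.
\<close>

inductive cox_step :: "('g, 'm) monoid_scheme \<Rightarrow> 'g set \<Rightarrow> 'g list \<Rightarrow> 'g list \<Rightarrow> bool"
  for G S where
  "\<lbrakk>s \<in> S; t \<in> S; group.ord G (s \<otimes>\<^bsub>G\<^esub> t) \<noteq> 0; us \<in> lists S; vs \<in> lists S\<rbrakk> \<Longrightarrow>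
    cox_step G S (us @ concat (replicate (group.ord G (s \<otimes>\<^bsub>G\<^esub> t)) [s, t]) @ vs) (us @ vs)"

text \<open>
  \<open>S\<close> generates \<open>G\<close>, its elements have order \<open>2\<close>, and \<open>G\<close> is presented by the
  relations \<open>(s t)\<^sup>m = 1\<close>, \<open>m\<close> the (finite) order of \<open>s t\<close>: every word representing the
  identity is equivalent to the empty word modulo these relations.
\<close>

definition coxeter_system :: "('g, 'm) monoid_scheme \<Rightarrow> 'g set \<Rightarrow> bool" where
  "coxeter_system G S \<longleftrightarrow>
     group G \<and> S \<subseteq> carrier G \<and> generate G S = carrier G \<and>
     (\<forall>s\<in>S. group.ord G s = 2) \<and>
     (\<forall>xs\<in>lists S. foldr (mult G) xs \<one>\<^bsub>G\<^esub> = \<one>\<^bsub>G\<^esub> \<longrightarrow> equivclp (cox_step G S) xs [])"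


section \<open>Geometric representations\<close>

definition orth_group :: "('a::real_vector \<Rightarrow> 'a \<Rightarrow> real) \<Rightarrow> ('a \<Rightarrow> 'a) monoid" where
  "orth_group B =
     \<lparr>carrier = {f. linear f \<and> bij f \<and> (\<forall>x y. B (f x) (f y) = B x y)},
      mult = (\<circ>), one = id\<rparr>"

definition reflection :: "('a::real_vector \<Rightarrow> 'a \<Rightarrow> real) \<Rightarrow> 'a \<Rightarrow> 'a \<Rightarrow> 'a" where
  "reflection B a v = v - (2 * (B a v / B a a)) *\<^sub>R a"

definition nonneg_cone :: "'a::real_vector set \<Rightarrow> 'a set" where
  "nonneg_cone A = {(\<Sum>a\<in>F. c a *\<^sub>R a) | F c. finite F \<and> F \<subseteq> A \<and> (\<forall>a\<in>F. (0::real) \<le> c a)}"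

lemma nonneg_cone_eq_convex_cone_hull: "nonneg_cone A = convex_cone hull A"
proof (rule antisym)
  show "nonneg_cone A \<subseteq> convex_cone hull A"
  proof
    fix x assume "x \<in> nonneg_cone A"
    then obtain F c where F: "finite F" "F \<subseteq> A" "\<forall>a\<in>F. (0::real) \<le> c a"
      and x: "x = (\<Sum>a\<in>F. c a *\<^sub>R a)"
      unfolding nonneg_cone_def by blast
    from F have "(\<Sum>a\<in>F. c a *\<^sub>R a) \<in> convex_cone hull A"
    proof (induction F rule: finite_induct)
      case empty
      show ?case by (simp add: convex_cone_hull_contains_0)
    next
      case (insert a F)
      then show ?case
        by (simp add: convex_cone_hull_add convex_cone_hull_mul hull_inc)
    qed
    then show "x \<in> convex_cone hull A" by (simp add: x)
  qed
next
  have sub: "A \<subseteq> nonneg_cone A"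
  proof
    fix a assume "a \<in> A"
    then show "a \<in> nonneg_cone A"
      unfolding nonneg_cone_def by (intro CollectI exI[of _ "{a}"] exI[of _ "\<lambda>_. 1"]) auto
  qed
  have zero: "0 \<in> nonneg_cone A"
    unfolding nonneg_cone_def by (intro CollectI exI[of _ "{}"]) auto
  have add: "x + y \<in> nonneg_cone A" if xy: "x \<in> nonneg_cone A" "y \<in> nonneg_cone A" for x y
  proof -
    from xy obtain F c G d where
      F: "finite F" "F \<subseteq> A" "\<forall>a\<in>F. (0::real) \<le> c a" "x = (\<Sum>a\<in>F. c a *\<^sub>R a)" and
      G: "finite G" "G \<subseteq> A" "\<forall>a\<in>G. (0::real) \<le> d a" "y = (\<Sum>a\<in>G. d a *\<^sub>R a)"
      unfolding nonneg_cone_def by blast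
    let ?c = "\<lambda>a. if a \<in> F then c a else 0" and ?d = "\<lambda>a. if a \<in> G then d a else 0"
    have hx: "x = (\<Sum>a\<in>F\<union>G. ?c a *\<^sub>R a)"
      unfolding F(4) by (rule sum.mono_neutral_cong_left) (use F G in auto)
    have hy: "y = (\<Sum>a\<in>F\<union>G. ?d a *\<^sub>R a)"
      unfolding G(4) by (rule sum.mono_neutral_cong_left) (use F G in auto)
    have "x + y = (\<Sum>a\<in>F\<union>G. ?c a *\<^sub>R a + ?d a *\<^sub>R a)"
      by (subst hx, subst hy, rule sum.distrib[symmetric])
    also have "\<dots> = (\<Sum>a\<in>F\<union>G. (?c a + ?d a) *\<^sub>R a)"
      by (rule sum.cong[OF refl], rule scaleR_add_left[symmetric])
    finally have sum: "x + y = (\<Sum>a\<in>F\<union>G. (?c a + ?d a) *\<^sub>R a)" .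
    have "finite (F \<union> G)" "F \<union> G \<subseteq> A" "\<forall>a\<in>F\<union>G. 0 \<le> ?c a + ?d a"
      using F G by auto
    then show ?thesis
      unfolding nonneg_cone_def mem_Collect_eq using sum
      by (intro exI[of _ "F \<union> G"] exI[of _ "\<lambda>a. ?c a + ?d a"] conjI)
  qed
  have scale: "k *\<^sub>R x \<in> nonneg_cone A" if k: "x \<in> nonneg_cone A" "0 \<le> k" for x k
  proof -
    from k obtain F c where
      F: "finite F" "F \<subseteq> A" "\<forall>a\<in>F. (0::real) \<le> c a" "x = (\<Sum>a\<in>F. c a *\<^sub>R a)"
      unfolding nonneg_cone_def by blast
    then have "k *\<^sub>R x = (\<Sum>a\<in>F. (k * c a) *\<^sub>R a)"
      by (simp add: scaleR_sum_right)
    moreover have "\<forall>a\<in>F. 0 \<le> k * c a"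
      using F k by auto
    ultimately show ?thesis
      unfolding nonneg_cone_def mem_Collect_eq using F(1,2)
      by (intro exI[of _ F] exI[of _ "\<lambda>a. k * c a"] conjI)
  qed
  have "convex_cone (nonneg_cone A)"
    using zero add scale convex_cone[of "nonneg_cone A"]
    unfolding convex_cone_def conic_def cone_def by blast
  then show "convex_cone hull A \<subseteq> nonneg_cone A"
    using sub by (intro hull_minimal)
qed

definition simple_system :: "('a::real_vector \<Rightarrow> 'a \<Rightarrow> real) \<Rightarrow> 'a set \<Rightarrow> bool" where
  "simple_system B \<Delta> \<longleftrightarrow>
     finite \<Delta> \<and>
     (\<forall>c. (\<forall>a\<in>\<Delta>. (0::real) \<le> c a) \<and> (\<Sum>a\<in>\<Delta>. c a *\<^sub>R a) = 0 \<longrightarrow> (\<forall>a\<in>\<Delta>. c a = 0)) \<and>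
     (\<forall>a\<in>\<Delta>. \<forall>b\<in>\<Delta>. a \<noteq> b \<longrightarrow> B a b \<in> {..-1} \<union> {- cos (pi / real k) | k. 2 \<le> k}) \<and>
     (\<forall>a\<in>\<Delta>. B a a = 1)"

text \<open>
  \<open>(W, S)\<close> is a Coxeter system with \<open>S\<close> finite, \<open>W\<close> is a subgroup of \<open>O\<^sub>B(V)\<close>, and
  \<open>s \<mapsto> \<alpha> s\<close> selects the simple roots, \<open>\<Delta> = \<alpha> ` S\<close>.
\<close>

definition geometric_coxeter_system ::
  "('a::real_vector \<Rightarrow> 'a \<Rightarrow> real) \<Rightarrow> ('a \<Rightarrow> 'a) set \<Rightarrow> ('a \<Rightarrow> 'a) set \<Rightarrow> (('a \<Rightarrow> 'a) \<Rightarrow> 'a) \<Rightarrow> bool" where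
  "geometric_coxeter_system B W S \<alpha> \<longleftrightarrow>
     subgroup W (orth_group B) \<and> finite S \<and>
     coxeter_system ((orth_group B)\<lparr>carrier := W\<rparr>) S \<and>
     simple_system B (\<alpha> ` S) \<and>
     (\<forall>s\<in>S. s = reflection B (\<alpha> s)) \<and>
     (\<forall>s\<in>S. \<forall>t\<in>S. s \<noteq> t \<longrightarrow>
        (let m = group.ord ((orth_group B)\<lparr>carrier := W\<rparr>) (s \<circ> t)
         in if m = 0 then B (\<alpha> s) (\<alpha> t) \<le> -1 else B (\<alpha> s) (\<alpha> t) = - cos (pi / real m)))"


section \<open>Roots, inversion sets and biclosed sets\<close>

definition roots :: "('a \<Rightarrow> 'a) set \<Rightarrow> 'a set \<Rightarrow> 'a set" where
  "roots W \<Delta> = {w a | w a. w \<in> W \<and> a \<in> \<Delta>}"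

definition pos_roots :: "('a::real_vector \<Rightarrow> 'a) set \<Rightarrow> 'a set \<Rightarrow> 'a set" where
  "pos_roots W \<Delta> = nonneg_cone \<Delta> \<inter> roots W \<Delta>"

definition neg_roots :: "('a::real_vector \<Rightarrow> 'a) set \<Rightarrow> 'a set \<Rightarrow> 'a set" where
  "neg_roots W \<Delta> = uminus ` pos_roots W \<Delta>"

definition inversions :: "('a::real_vector \<Rightarrow> 'a) set \<Rightarrow> 'a set \<Rightarrow> ('a \<Rightarrow> 'a) \<Rightarrow> 'a set" where
  "inversions W \<Delta> w = pos_roots W \<Delta> \<inter> w ` neg_roots W \<Delta>"

definition closed_roots :: "('a::real_vector \<Rightarrow> 'a) set \<Rightarrow> 'a set \<Rightarrow> 'a set \<Rightarrow> bool" where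
  "closed_roots W \<Delta> A \<longleftrightarrow>
     A \<subseteq> pos_roots W \<Delta> \<and> (\<forall>a\<in>A. \<forall>b\<in>A. nonneg_cone {a, b} \<inter> roots W \<Delta> \<subseteq> A)"

definition biclosed_roots :: "('a::real_vector \<Rightarrow> 'a) set \<Rightarrow> 'a set \<Rightarrow> 'a set \<Rightarrow> bool" where
  "biclosed_roots W \<Delta> A \<longleftrightarrow>
     A \<subseteq> pos_roots W \<Delta> \<and> closed_roots W \<Delta> A \<and> closed_roots W \<Delta> (pos_roots W \<Delta> - A)"


section \<open>Hyperplanes, normalized roots and limit roots\<close>

definition affine_hyperplane :: "'a::euclidean_space set \<Rightarrow> bool" where
  "affine_hyperplane X \<longleftrightarrow> affine X \<and> aff_dim X = int DIM('a) - 1"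

definition linear_hyperplane :: "'a::euclidean_space set \<Rightarrow> bool" where
  "linear_hyperplane H \<longleftrightarrow> subspace H \<and> dim H = DIM('a) - 1"

definition open_half_space :: "'a::euclidean_space set \<Rightarrow> 'a set \<Rightarrow> bool" where
  "open_half_space H P \<longleftrightarrow>
     linear_hyperplane H \<and>
     (\<exists>f :: 'a \<Rightarrow> real. linear f \<and> H = {x. f x = 0} \<and> P = {x. f x > 0})"

definition ray :: "'a::real_vector \<Rightarrow> 'a set" where
  "ray b = {c *\<^sub>R b | c. 0 \<le> c}"

definition transverse :: "'a::euclidean_space set \<Rightarrow> 'a set \<Rightarrow> bool" where
  "transverse X P \<longleftrightarrow> affine_hyperplane X \<and> (\<forall>b\<in>P. \<exists>!p. p \<in> ray b \<inter> X \<and> p \<noteq> 0)"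

text \<open>The second branch is used for negative roots, where the normalization is that of \<open>-b\<close>.\<close>

definition normalized_root ::
  "('a::euclidean_space \<Rightarrow> 'a) set \<Rightarrow> 'a set \<Rightarrow> 'a set \<Rightarrow> 'a \<Rightarrow> 'a" where
  "normalized_root W \<Delta> V\<^sub>1 b =
     (if b \<in> pos_roots W \<Delta> then THE p. p \<in> ray b \<inter> V\<^sub>1 \<and> p \<noteq> 0
      else THE p. p \<in> ray (- b) \<inter> V\<^sub>1 \<and> p \<noteq> 0)"

definition limit_roots ::
  "('a::euclidean_space \<Rightarrow> 'a) set \<Rightarrow> 'a set \<Rightarrow> 'a set \<Rightarrow> 'a set" where
  "limit_roots W \<Delta> V\<^sub>1 = {x \<in> V\<^sub>1. x islimpt (normalized_root W \<Delta> V\<^sub>1 ` roots W \<Delta>)}"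

definition imaginary_convex_body ::
  "('a::euclidean_space \<Rightarrow> 'a) set \<Rightarrow> 'a set \<Rightarrow> 'a set \<Rightarrow> 'a set" where
  "imaginary_convex_body W \<Delta> V\<^sub>1 = convex hull (limit_roots W \<Delta> V\<^sub>1)"

end

theory Submission
  imports Defs
begin

text \<open>
  Let \<open>f\<close> be a linear functional with kernel \<open>H\<close>, positive on \<open>H\<^sup>+\<close>. The two disjointness conditions
  say that \<open>f < 0\<close> on \<open>conv(E)\<close>. If infinitely many positive roots had \<open>f > 0\<close>, their normalizations,
  which lie in a bounded set, would accumulate at a limit root with \<open>f \<ge> 0\<close>. So
  \<open>A = \<Phi>\<^sup>+ \<inter> H\<^sup>+\<close> is finite, and it is biclosed because it is cut out by a half-space.
  Both directions now rest on the fact that every finite biclosed set is an inversion set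
  (\<open>finite_biclosed_is_inversions\<close>). Conversely, if \<open>A = N(w)\<close>, let \<open>\<phi>\<close> be a functional positive on
  \<open>\<Phi>\<^sup>+\<close>, which the transverse hyperplane provides, and take \<open>f = - \<phi> \<circ> w\<inverse>\<close>. The positive roots
  with \<open>f > 0\<close> are exactly those in \<open>N(w)\<close>; since \<open>N(w)\<close> is finite, every limit root is approached by
  normalized roots that \<open>w\<inverse>\<close> keeps in the cone over \<open>\<Delta>\<close>, and the estimate \<open>\<parallel>x\<parallel> \<le> M \<phi>(x)\<close> on that cone
  survives in the limit and gives \<open>f < 0\<close> there (\<open>limit_root_positive\<close>).

  A finite biclosed set is peeled off one simple root at a time. A nonempty one contains a simple
  root \<open>\<alpha> s\<close>: take in it a root of minimal \<open>\<phi>\<close> and reflect it down. Removing \<open>\<alpha> s\<close> and reflecting the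
  rest by \<open>s\<close> gives a smaller biclosed set, which by induction is some \<open>N(w)\<close>, and then the original
  set is \<open>N(s w)\<close>. This uses that \<open>s\<close> permutes \<open>\<Phi>\<^sup>+ - {\<alpha> s}\<close>, hence that every root is positive or
  negative (\<open>root_pos_or_neg\<close>).

  That last fact is the classical theorem that \<open>l(w s) > l(w)\<close> implies \<open>w (\<alpha> s) \<in> cone(\<Delta>)\<close>
  (\<open>ascent_imp_positive\<close>), proved by induction on the length with a reduction to the dihedral
  subgroups. The Coxeter presentation enters through the sign character, which ensures that
  \<open>l(w s) \<noteq> l(w)\<close>, and through the orders of the products \<open>s t\<close>. The simple roots are only positively independent; linear independence is replaced
  by the facts that their cone is salient and that they span extreme rays of it.
\<close>

section \<open>Words and length\<close>

locale geometric_representation =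
  fixes B :: "'a::euclidean_space \<Rightarrow> 'a \<Rightarrow> real"
    and W S :: "('a \<Rightarrow> 'a) set"
    and \<alpha> :: "('a \<Rightarrow> 'a) \<Rightarrow> 'a"
  assumes bilinear: "bilinear B"
    and sym: "B x y = B y x"
    and geometric: "geometric_coxeter_system B W S \<alpha>"
begin

abbreviation \<Delta> where "\<Delta> \<equiv> \<alpha> ` S"
abbreviation G where "G \<equiv> (orth_group B)\<lparr>carrier := W\<rparr>"

lemma B_simps:
  "B (x + y) z = B x z + B y z" "B z (x + y) = B z x + B z y"
  "B (x - y) z = B x z - B y z" "B z (x - y) = B z x - B z y"
  "B (c *\<^sub>R x) z = c * B x z" "B z (c *\<^sub>R x) = c * B z x"
  "B (- x) z = - B x z" "B z (- x) = - B z x"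
  using bilinear
  by (simp_all add: bilinear_ladd bilinear_radd bilinear_lsub bilinear_rsub
      bilinear_lmul bilinear_rmul bilinear_lneg bilinear_rneg)

lemma coxeter: "coxeter_system G S"
  and finite_S: "finite S"
  and simple: "simple_system B \<Delta>"
  and subgroup_W: "subgroup W (orth_group B)"
  and gen_eq: "s \<in> S \<Longrightarrow> s = reflection B (\<alpha> s)"
  using geometric by (auto simp: geometric_coxeter_system_def)

lemma group_G: "group G"
  using coxeter by (simp add: coxeter_system_def)

lemma gen_in_W: "s \<in> S \<Longrightarrow> s \<in> W"
  using coxeter by (auto simp: coxeter_system_def)

lemma W_maps:
  assumes "w \<in> W"
  shows W_linear: "linear w" and W_bij: "bij w" and W_B: "B (w x) (w y) = B x y"
  using subgroup.subset[OF subgroup_W] assms by (auto simp: orth_group_def)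

lemma id_in_W: "id \<in> W"
  using group.is_monoid[OF group_G] monoid.one_closed[of G] by (simp add: orth_group_def)

lemma comp_in_W: "v \<in> W \<Longrightarrow> w \<in> W \<Longrightarrow> v \<circ> w \<in> W"
  using group.is_monoid[OF group_G] monoid.m_closed[of G v w] by (simp add: orth_group_def)

text \<open>
  The name \<open>inv\<close> is taken by the group inverse, whose notation refers to an ambient structure.
\<close>

abbreviation inv_map :: "('a \<Rightarrow> 'a) \<Rightarrow> 'a \<Rightarrow> 'a" where
  "inv_map \<equiv> inv_into UNIV"

lemma inv_in_W:
  assumes "w \<in> W"
  shows "inv_map w \<in> W"
proof -
  obtain v where v: "v \<in> W" "v \<circ> w = id"
    using group.l_inv_ex[OF group_G, of w] assms by (auto simp: orth_group_def)
  have "inv_map w = v \<circ> w \<circ> inv_map w" using v by simp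
  also have "\<dots> = v" using W_bij[OF assms] using surj_iff[of w] bij_is_surj[OF W_bij[OF assms]] by (metis comp_assoc comp_id)
  finally show ?thesis using v by simp
qed

lemma root_norm: "s \<in> S \<Longrightarrow> B (\<alpha> s) (\<alpha> s) = 1"
  using simple by (auto simp: simple_system_def)

lemma gen_apply: "s \<in> S \<Longrightarrow> s v = v - (2 * B (\<alpha> s) v) *\<^sub>R \<alpha> s"
  using gen_eq[of s] root_norm[of s] unfolding reflection_def by (metis div_by_1)

lemma gen_root: "s \<in> S \<Longrightarrow> s (\<alpha> s) = - \<alpha> s"
  by (simp add: gen_apply root_norm scaleR_2)

lemma gen_gen: "s \<in> S \<Longrightarrow> s (s v) = v"
  by (simp add: gen_apply root_norm B_simps algebra_simps flip: scaleR_add_left)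

lemma gen_comp_gen: "s \<in> S \<Longrightarrow> s \<circ> s = id"
  by (auto simp: fun_eq_iff gen_gen)

definition word_map :: "('a \<Rightarrow> 'a) list \<Rightarrow> 'a \<Rightarrow> 'a" where
  "word_map xs = foldr (\<circ>) xs id"

lemma word_map_simps [simp]:
  "word_map [] = id" "word_map (x # xs) = x \<circ> word_map xs"
  "word_map (xs @ ys) = word_map xs \<circ> word_map ys"
  unfolding word_map_def by (simp, simp, induction xs) (auto simp: comp_assoc)

lemma word_map_rev: "xs \<in> lists S \<Longrightarrow> word_map xs \<circ> word_map (rev xs) = id"
  by (induction xs) (auto simp: fun_eq_iff gen_gen)

lemma word_exists:
  assumes "w \<in> W"
  shows "\<exists>xs\<in>lists S. word_map xs = w"
proof -
  have "w \<in> generate G S" using coxeter assms by (simp add: coxeter_system_def)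
  then show ?thesis
  proof induction
    case one
    then show ?case by (intro bexI[of _ "[]"]) (auto simp: orth_group_def)
  next
    case (incl h)
    then show ?case by (intro bexI[of _ "[h]"]) auto
  next
    case (inv h)
    have "inv\<^bsub>G\<^esub> h = h"
      by (rule group.inv_equality[OF group_G])
        (use inv gen_comp_gen gen_in_W in \<open>auto simp: orth_group_def\<close>)
    with inv show ?case by (intro bexI[of _ "[h]"]) auto
  next
    case (eng g h)
    then obtain xs ys where "xs \<in> lists S" "ys \<in> lists S" "word_map xs = g" "word_map ys = h"
      by blast
    then show ?case by (intro bexI[of _ "xs @ ys"]) (auto simp: orth_group_def)
  qed
qed

text \<open>
  The defining relations \<open>(s t)\<^sup>m = 1\<close> have even length, so every word for the identity has
  even length: this is the sign character of \<open>W\<close>.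
\<close>

lemma even_length_of_id_word:
  assumes "xs \<in> lists S" "word_map xs = id"
  shows "even (length xs)"
proof -
  have "equivclp (cox_step G S) xs []"
    using coxeter assms by (auto simp: coxeter_system_def word_map_def orth_group_def)
  then have "even (length xs) = even (length ([] :: ('a \<Rightarrow> 'a) list))"
  proof (induction rule: equivclp_induct)
    case (step y z)
    have "even (length u) = even (length v)" if "cox_step G S u v" for u v
      using that by cases (auto simp: length_concat sum_list_replicate)
    with step show ?case by blast
  qed simp
  then show ?thesis by simp
qed

definition len :: "('a \<Rightarrow> 'a) \<Rightarrow> nat" where
  "len w = (LEAST n. \<exists>xs\<in>lists S. length xs = n \<and> word_map xs = w)"

lemma len_le: "xs \<in> lists S \<Longrightarrow> len (word_map xs) \<le> length xs"
  unfolding len_def by (rule Least_le) auto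

lemma reduced_word:
  assumes "w \<in> W"
  obtains xs where "xs \<in> lists S" "length xs = len w" "word_map xs = w"
proof -
  have "\<exists>n. \<exists>xs\<in>lists S. length xs = n \<and> word_map xs = w"
    using word_exists[OF assms] by auto
  from LeastI_ex[OF this] show ?thesis
    unfolding len_def[symmetric] using that by blast
qed

lemma len_comp: "v \<in> W \<Longrightarrow> w \<in> W \<Longrightarrow> len (v \<circ> w) \<le> len v + len w"
  by (metis reduced_word append_in_lists_conv len_le length_append word_map_simps(3))

lemma len_id: "len id = 0"
  using len_le[of "[]"] by simp

lemma len_gen: "s \<in> S \<Longrightarrow> len s \<le> 1"
  using len_le[of "[s]"] by simp

lemma len_comp_gen:
  assumes "w \<in> W" "s \<in> S"
  shows "len (w \<circ> s) = len w + 1 \<or> len w = len (w \<circ> s) + 1"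
proof -
  have ws: "w \<circ> s \<in> W" using assms by (simp add: comp_in_W gen_in_W)
  obtain xs where xs: "xs \<in> lists S" "length xs = len w" "word_map xs = w"
    using reduced_word assms by blast
  obtain ys where ys: "ys \<in> lists S" "length ys = len (w \<circ> s)" "word_map ys = w \<circ> s"
    using reduced_word ws by blast
  have "word_map (xs @ [s] @ rev ys) = id"
    using word_map_rev[OF ys(1)] xs(3) ys(3) by (simp add: comp_assoc)
  then have "even (length (xs @ [s] @ rev ys))"
    by (intro even_length_of_id_word) (use xs ys assms in auto)
  then have "even (len w + 1 + len (w \<circ> s))" using xs ys by simp
  moreover have "len (w \<circ> s) \<le> len w + 1"
    using len_comp[OF assms(1) gen_in_W[OF assms(2)]] len_gen[OF assms(2)] by simp
  moreover have "len w \<le> len (w \<circ> s) + 1"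
    using len_comp[OF ws gen_in_W[OF assms(2)]] len_gen[OF assms(2)] gen_comp_gen[OF assms(2)]
    by (simp add: comp_assoc)
  ultimately show ?thesis by (cases "len (w \<circ> s) = len w") (simp, linarith)
qed

section \<open>Alternating products of two generators\<close>

text \<open>The product of \<open>n\<close> alternating factors, of which \<open>s\<close> is applied first.\<close>

primrec alt_prod :: "('a \<Rightarrow> 'a) \<Rightarrow> ('a \<Rightarrow> 'a) \<Rightarrow> nat \<Rightarrow> 'a \<Rightarrow> 'a" where
  "alt_prod s t 0 = id"
| "alt_prod s t (Suc n) = (if even n then s else t) \<circ> alt_prod s t n"

lemma alt_prod_Suc_right: "alt_prod s t (Suc n) = alt_prod t s n \<circ> s"
proof (induction n)
  case (Suc n)
  have "alt_prod s t (Suc (Suc n)) = (if even (Suc n) then s else t) \<circ> (alt_prod t s n \<circ> s)"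
    by (simp only: alt_prod.simps(2)[of s t "Suc n"] Suc)
  then show ?case by (auto simp: comp_assoc)
qed simp

lemma alt_prod_in_W: "s \<in> S \<Longrightarrow> t \<in> S \<Longrightarrow> alt_prod s t n \<in> W"
  by (induction n) (simp_all add: id_in_W comp_in_W gen_in_W)

lemma len_gen_comp_le: "s \<in> S \<Longrightarrow> w \<in> W \<Longrightarrow> len (s \<circ> w) \<le> len w + 1"
  using len_comp[of s w] len_gen[of s] gen_in_W[of s] by simp

lemma len_alt_prod_le: 
  assumes "s \<in> S" "t \<in> S"
  shows "len (alt_prod s t n) \<le> n"
proof (induction n)
  case (Suc n)
  have "(if even n then s else t) \<in> S" using assms by simp
  from len_gen_comp_le[OF this alt_prod_in_W[OF assms]] Suc
  show ?case unfolding alt_prod.simps by (metis add_le_mono1 order_trans Suc_eq_plus1)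
next
  case 0
  show ?case unfolding alt_prod.simps len_id by simp
qed

lemma alt_prod_double: "alt_prod s t (2 * m) = (t \<circ> s) ^^ m"
  by (induction m) (auto simp: comp_assoc)

text \<open>
  Among the \<open>2 m\<close> factors of the relation \<open>(t s)\<^sup>m = 1\<close>, the complement of \<open>m + 1\<close> consecutive
  ones has only \<open>m - 1\<close> factors, which saves two; each further factor costs at most one.
\<close>

lemma len_alt_prod_not_reduced:
  assumes "s \<in> S" "t \<in> S" "(t \<circ> s) ^^ m = id" "0 < m" "m < n"
  shows "len (alt_prod s t n) + 2 \<le> n"
proof -
  have down: "len (alt_prod s t (2 * m - k)) \<le> k" if "k \<le> 2 * m" for k
    using that
  proof (induction k)
    case 0
    show ?case unfolding diff_zero alt_prod_double assms(3) len_id by simp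
  next
    case (Suc k)
    let ?n = "2 * m - Suc k" and ?r = "if even (2 * m - Suc k) then s else t"
    have n: "2 * m - k = Suc ?n" using Suc.prems by simp
    have r: "?r \<in> S" using assms by simp
    have eq: "alt_prod s t ?n = ?r \<circ> alt_prod s t (2 * m - k)"
      unfolding n alt_prod.simps(2) comp_assoc[symmetric] gen_comp_gen[OF r] by simp
    have "len (?r \<circ> alt_prod s t (2 * m - k)) \<le> len (alt_prod s t (2 * m - k)) + 1"
      by (rule len_gen_comp_le[OF r alt_prod_in_W[OF assms(1,2)]])
    also have "\<dots> \<le> Suc k" using Suc by simp
    finally show ?case unfolding eq .
  qed
  have "m + 1 \<le> n" using assms by simp
  then show ?thesis
  proof (induction n rule: dec_induct)
    case base
    have "2 * m - (m - 1) = m + 1" using assms by simp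
    with down[of "m - 1"] have "len (alt_prod s t (m + 1)) \<le> m - 1" by simp
    then show ?case using assms(4) by linarith
  next
    case (step n)
    have "(if even n then s else t) \<in> S" using assms by simp
    from len_gen_comp_le[OF this alt_prod_in_W[OF assms(1,2)], of n] step(3)
    show ?case unfolding alt_prod.simps by linarith
  qed
qed

text \<open>
  Chebyshev polynomials of the second kind, shifted by one so that the value at \<open>0\<close> is \<open>0\<close>.
\<close>

fun cheb :: "real \<Rightarrow> nat \<Rightarrow> real" where
  "cheb c 0 = 0"
| "cheb c (Suc 0) = 1"
| "cheb c (Suc (Suc n)) = 2 * c * cheb c (Suc n) - cheb c n"

lemma cheb_nonneg_of_ge_1:
  assumes "1 \<le> c"
  shows "0 \<le> cheb c n"
proof -
  have "0 \<le> cheb c n \<and> cheb c n \<le> cheb c (Suc n)"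
  proof (induction n)
    case (Suc n)
    then have "2 * 1 * cheb c (Suc n) \<le> 2 * c * cheb c (Suc n)"
      using assms by (intro mult_right_mono) auto
    then show ?case using Suc by simp
  qed simp
  then show ?thesis by simp
qed

lemma cheb_cos: "cheb (cos \<theta>) n * sin \<theta> = sin (real n * \<theta>)"
proof (induction "cos \<theta>" n rule: cheb.induct)
  case (3 n)
  have a: "real (Suc (Suc n)) * \<theta> = real (Suc n) * \<theta> + \<theta>"
    and b: "real n * \<theta> = real (Suc n) * \<theta> - \<theta>"
    by (simp_all add: algebra_simps)
  have "sin (real (Suc (Suc n)) * \<theta>) + sin (real n * \<theta>) = 2 * cos \<theta> * sin (real (Suc n) * \<theta>)"
    unfolding a b sin_add sin_diff by simp
  then show ?case
    unfolding cheb.simps(3) left_diff_distrib mult.assoc[of "2 * cos \<theta>"] 3 by linarith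
qed auto

lemma cheb_nonneg_of_cos:
  assumes "2 \<le> m" "n \<le> m"
  shows "0 \<le> cheb (cos (pi / real m)) n"
proof -
  have "0 \<le> sin (real n * (pi / real m))"
    by (rule sin_ge_zero) (use assms in \<open>auto simp: field_simps\<close>)
  moreover have "0 < sin (pi / real m)"
    by (rule sin_gt_zero) (use assms in \<open>auto simp: field_simps\<close>)
  ultimately show ?thesis
    by (metis cheb_cos zero_le_mult_iff not_le)
qed

lemma gen_on_plane:
  assumes "s \<in> S"
  shows "s (a *\<^sub>R \<alpha> t + b *\<^sub>R \<alpha> s) = (- 2 * B (\<alpha> s) (\<alpha> t) * a - b) *\<^sub>R \<alpha> s + a *\<^sub>R \<alpha> t"
proof -
  have "2 * B (\<alpha> s) (a *\<^sub>R \<alpha> t + b *\<^sub>R \<alpha> s) = 2 * B (\<alpha> s) (\<alpha> t) * a + b + b"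
    by (simp add: B_simps root_norm[OF assms])
  moreover have "(2 * b) *\<^sub>R \<alpha> s = b *\<^sub>R \<alpha> s + b *\<^sub>R \<alpha> s"
    by (simp add: scaleR_2 flip: scaleR_scaleR)
  ultimately show ?thesis
    using gen_apply[OF assms, of "a *\<^sub>R \<alpha> t + b *\<^sub>R \<alpha> s"]
    by (simp add: scaleR_add_left scaleR_diff_left)
qed

lemma alt_prod_root:
  assumes "s \<in> S" "t \<in> S"
  defines "u \<equiv> cheb (- B (\<alpha> s) (\<alpha> t))"
  shows "alt_prod t s n (\<alpha> s) =
    u (Suc n) *\<^sub>R \<alpha> (if even n then s else t) + u n *\<^sub>R \<alpha> (if even n then t else s)"
proof (induction n)
  case (Suc n)
  let ?r = "if even n then s else t" and ?r' = "if even n then t else s"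
  have r': "?r' \<in> S" using assms by simp
  have rec: "u (Suc (Suc n)) = - 2 * B (\<alpha> ?r') (\<alpha> ?r) * u (Suc n) - u n"
    using sym[of "\<alpha> s" "\<alpha> t"] by (simp add: u_def)
  have "alt_prod t s (Suc n) (\<alpha> s) = ?r' (u (Suc n) *\<^sub>R \<alpha> ?r + u n *\<^sub>R \<alpha> ?r')"
    unfolding alt_prod.simps comp_apply Suc ..
  also have "\<dots> = u (Suc (Suc n)) *\<^sub>R \<alpha> ?r' + u (Suc n) *\<^sub>R \<alpha> ?r"
    unfolding gen_on_plane[OF r'] rec ..
  finally show ?case by (cases "even n") auto
qed (simp add: u_def)

text \<open>
  The angle between two simple roots matches the order of the product of their reflections: this
  is what couples the coefficients of \<open>alt_prod_root\<close> with the lengths of alternating products.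
\<close>

lemma dihedral_cases:
  assumes "s \<in> S" "t \<in> S" "s \<noteq> t"
  obtains "1 \<le> - B (\<alpha> s) (\<alpha> t)"
  | m where "2 \<le> m" "(s \<circ> t) ^^ m = id" "- B (\<alpha> s) (\<alpha> t) = cos (pi / real m)"
proof -
  define m where "m = group.ord G (s \<circ> t)"
  have st: "s \<circ> t \<in> W" using assms by (simp add: comp_in_W gen_in_W)
  have pow: "x [^]\<^bsub>G\<^esub> (n::nat) = x ^^ n" for x n
    by (induction n) (auto simp: orth_group_def nat_pow_def funpow_Suc_right simp del: funpow.simps(2))
  have one: "(s \<circ> t) ^^ m = id"
    using group.pow_ord_eq_1[OF group_G, of "s \<circ> t"] st
    unfolding m_def pow by (simp add: orth_group_def)
  have "m \<noteq> 1"
  proof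
    assume "m = 1"
    with one have st1: "s \<circ> t = id" by simp
    have "s \<circ> (s \<circ> t) = t" using gen_comp_gen[OF assms(1)] by (simp flip: comp_assoc)
    with st1 assms show False by simp
  qed
  moreover have "if m = 0 then B (\<alpha> s) (\<alpha> t) \<le> -1 else B (\<alpha> s) (\<alpha> t) = - cos (pi / real m)"
    using geometric assms unfolding geometric_coxeter_system_def m_def Let_def by blast
  ultimately show ?thesis using that(1) that(2)[of m] one by (cases "m = 0") auto
qed

section \<open>Positive and negative roots\<close>

abbreviation "simple_cone \<equiv> nonneg_cone \<Delta>"
abbreviation "\<Phi> \<equiv> roots W \<Delta>"
abbreviation "pos \<equiv> pos_roots W \<Delta>"

lemma nonneg_cone_add: "x \<in> nonneg_cone A \<Longrightarrow> y \<in> nonneg_cone A \<Longrightarrow> x + y \<in> nonneg_cone A"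
  unfolding nonneg_cone_eq_convex_cone_hull by (rule convex_cone_hull_add)

lemma nonneg_cone_scale: "x \<in> nonneg_cone A \<Longrightarrow> 0 \<le> c \<Longrightarrow> c *\<^sub>R x \<in> nonneg_cone A"
  unfolding nonneg_cone_eq_convex_cone_hull by (rule convex_cone_hull_mul)

lemma nonneg_cone_incl: "x \<in> A \<Longrightarrow> x \<in> nonneg_cone A"
  unfolding nonneg_cone_eq_convex_cone_hull by (rule hull_inc)

lemma nonneg_cone_finite:
  assumes "finite A"
  shows "x \<in> nonneg_cone A \<longleftrightarrow> (\<exists>c. (\<forall>a\<in>A. 0 \<le> c a) \<and> x = (\<Sum>a\<in>A. c a *\<^sub>R a))"
proof
  assume "x \<in> nonneg_cone A"
  then obtain F c where F: "finite F" "F \<subseteq> A" "\<forall>a\<in>F. (0::real) \<le> c a" "x = (\<Sum>a\<in>F. c a *\<^sub>R a)"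
    unfolding nonneg_cone_def by blast
  have "x = (\<Sum>a\<in>A. (if a \<in> F then c a else 0) *\<^sub>R a)"
    unfolding F(4) by (rule sum.mono_neutral_cong_left) (use F assms in auto)
  then show "\<exists>c. (\<forall>a\<in>A. 0 \<le> c a) \<and> x = (\<Sum>a\<in>A. c a *\<^sub>R a)"
    by (intro exI[of _ "\<lambda>a. if a \<in> F then c a else 0"]) (use F in auto)
qed (use assms in \<open>auto simp: nonneg_cone_def\<close>)

lemma nonneg_cone_pair:
  "x \<in> nonneg_cone {a, b} \<longleftrightarrow> (\<exists>p q. 0 \<le> p \<and> 0 \<le> q \<and> x = p *\<^sub>R a + q *\<^sub>R b)" for a b x :: 'a
proof (cases "a = b")
  case True
  have "(\<exists>p\<ge>0. x = p *\<^sub>R b) \<longleftrightarrow> (\<exists>p q. 0 \<le> p \<and> 0 \<le> q \<and> x = p *\<^sub>R b + q *\<^sub>R b)"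
    by (metis add.right_neutral add_nonneg_nonneg order_refl scaleR_add_left scaleR_zero_left)
  moreover have "x \<in> nonneg_cone {b} \<longleftrightarrow> (\<exists>p\<ge>0. x = p *\<^sub>R b)"
    unfolding nonneg_cone_finite[OF finite.insertI[OF finite.emptyI]] by auto
  ultimately show ?thesis using True by simp
next
  case False
  have "(\<exists>c :: 'a \<Rightarrow> real. (\<forall>y\<in>{a, b}. 0 \<le> c y) \<and> x = (\<Sum>y\<in>{a, b}. c y *\<^sub>R y)) \<longleftrightarrow>
      (\<exists>p q. 0 \<le> p \<and> 0 \<le> q \<and> x = p *\<^sub>R a + q *\<^sub>R b)"
    (is "?L = ?R")
  proof
    assume ?R
    then obtain p q where "0 \<le> p" "0 \<le> q" "x = p *\<^sub>R a + q *\<^sub>R b" by blast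
    then show ?L using False by (intro exI[of _ "\<lambda>y. if y = a then p else q"]) auto
  qed (use False in auto)
  then show ?thesis by (simp add: nonneg_cone_finite)
qed

lemma finite_simple: "finite \<Delta>"
  using finite_S by simp

lemma pos_independent:
  assumes "\<forall>a\<in>\<Delta>. 0 \<le> c a" "(\<Sum>a\<in>\<Delta>. c a *\<^sub>R a) = 0" "a \<in> \<Delta>"
  shows "c a = (0::real)"
  using simple assms unfolding simple_system_def by blast

lemma simple_obtuse:
  assumes "a \<in> \<Delta>" "b \<in> \<Delta>" "a \<noteq> b"
  shows "B a b \<le> 0"
proof -
  have "B a b \<in> {..-1} \<union> {- cos (pi / real k) | k. 2 \<le> k}"
    using simple assms unfolding simple_system_def by blast
  moreover have "0 \<le> cos (pi / real k)" if "2 \<le> k" for k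
    by (rule cos_ge_zero) (use that in \<open>auto simp: field_simps intro: order_trans[of _ 0]\<close>)
  ultimately show ?thesis by fastforce
qed

lemma simple_norm: "a \<in> \<Delta> \<Longrightarrow> B a a = 1"
  using root_norm by auto

text \<open>The cone over the simple roots is salient, as they are positively independent.\<close>

lemma simple_cone_salient:
  assumes "x \<in> simple_cone" "- x \<in> simple_cone"
  shows "x = 0"
proof -
  obtain c where c: "\<forall>a\<in>\<Delta>. 0 \<le> c a" "x = (\<Sum>a\<in>\<Delta>. c a *\<^sub>R a)"
    using assms(1) nonneg_cone_finite[OF finite_simple] by blast
  obtain d where d: "\<forall>a\<in>\<Delta>. 0 \<le> d a" "- x = (\<Sum>a\<in>\<Delta>. d a *\<^sub>R a)"
    using assms(2) nonneg_cone_finite[OF finite_simple] by blast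
  have "(\<Sum>a\<in>\<Delta>. (c a + d a) *\<^sub>R a) = 0"
    by (simp add: scaleR_add_left sum.distrib flip: c d)
  then have "c a + d a = 0" if "a \<in> \<Delta>" for a
    using pos_independent[of "\<lambda>a. c a + d a" a] c(1) d(1) that by simp
  then have "c a = 0" if "a \<in> \<Delta>" for a
    using c(1) d(1) that by (metis add_nonneg_eq_0_iff)
  then show ?thesis unfolding c(2) by simp
qed

lemma B_sum_right: "B x (\<Sum>a\<in>A. c a *\<^sub>R a) = (\<Sum>a\<in>A. c a * B x a)"
  using linear_sum[of "B x" "\<lambda>a. c a *\<^sub>R a" A] bilinear unfolding bilinear_def
  by (simp add: B_simps)

text \<open>
  Each simple root spans an extreme ray of the cone. This is automatic for linearly independent
  simple roots; here it comes from the obtuse angles between them.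
\<close>

lemma simple_extreme:
  assumes "a \<in> \<Delta>" "x \<in> simple_cone" "y \<in> simple_cone" "x + y = k *\<^sub>R a"
  shows "\<exists>p\<ge>0. x = p *\<^sub>R a"
proof -
  obtain c where c: "\<forall>b\<in>\<Delta>. 0 \<le> c b" "x = (\<Sum>b\<in>\<Delta>. c b *\<^sub>R b)"
    using assms(2) nonneg_cone_finite[OF finite_simple] by blast
  obtain d where d: "\<forall>b\<in>\<Delta>. 0 \<le> d b" "y = (\<Sum>b\<in>\<Delta>. d b *\<^sub>R b)"
    using assms(3) nonneg_cone_finite[OF finite_simple] by blast
  define e where "e b = c b + d b" for b
  have e: "\<forall>b\<in>\<Delta>. 0 \<le> e b" using c d by (simp add: e_def)
  have xy: "x + y = (\<Sum>b\<in>\<Delta>. e b *\<^sub>R b)"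
    unfolding c(2) d(2) e_def by (simp add: scaleR_add_left sum.distrib)
  have split: "k *\<^sub>R a = e a *\<^sub>R a + (\<Sum>b\<in>\<Delta>-{a}. e b *\<^sub>R b)"
    using xy assms sum.remove[OF finite_simple assms(1), of "\<lambda>b. e b *\<^sub>R b"] by simp
  have "B a (k *\<^sub>R a) = e a + (\<Sum>b\<in>\<Delta>-{a}. e b * B a b)"
    unfolding split B_simps(2) B_sum_right by (simp add: B_simps simple_norm assms)
  moreover have "(\<Sum>b\<in>\<Delta>-{a}. e b * B a b) \<le> 0"
    by (rule sum_nonpos) (use e simple_obtuse assms(1) in \<open>auto intro!: mult_nonneg_nonpos\<close>)
  ultimately have "k \<le> e a" using assms(1) by (simp add: B_simps simple_norm)
  \<comment> \<open>subtracting \<open>k a\<close> leaves a nonnegative relation, to which positive independence applies\<close>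
  define f where "f b = (if b = a then e a - k else e b)" for b
  have "(\<Sum>b\<in>\<Delta>. f b *\<^sub>R b) = (e a - k) *\<^sub>R a + (\<Sum>b\<in>\<Delta>-{a}. f b *\<^sub>R b)"
    using sum.remove[OF finite_simple assms(1), of "\<lambda>b. f b *\<^sub>R b"] by (simp add: f_def)
  also have "(\<Sum>b\<in>\<Delta>-{a}. f b *\<^sub>R b) = (\<Sum>b\<in>\<Delta>-{a}. e b *\<^sub>R b)"
    by (rule sum.cong) (auto simp: f_def)
  also have "(e a - k) *\<^sub>R a + (\<Sum>b\<in>\<Delta>-{a}. e b *\<^sub>R b) = 0"
    using split by (simp add: algebra_simps)
  finally have "(\<Sum>b\<in>\<Delta>. f b *\<^sub>R b) = 0" .
  moreover have "\<forall>b\<in>\<Delta>. 0 \<le> f b" using e \<open>k \<le> e a\<close> by (simp add: f_def)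
  ultimately have "e b = 0" if "b \<in> \<Delta>" "b \<noteq> a" for b
    using pos_independent[of f b] that by (simp add: f_def)
  then have "c b = 0" if "b \<in> \<Delta>" "b \<noteq> a" for b
    using that c(1) d(1) by (metis e_def add_nonneg_eq_0_iff)
  then have "x = c a *\<^sub>R a"
    using sum.remove[OF finite_simple assms(1), of "\<lambda>b. c b *\<^sub>R b"] c(2) by simp
  then show ?thesis using c(1) assms(1) by blast
qed

text \<open>
  Right multiplication by \<open>s\<close> lengthens \<open>w\<close> only if \<open>w\<close> keeps \<open>\<alpha> s\<close>
  positive. By induction on the length one strips from \<open>w\<close> a longest possible alternating
  suffix in \<open>s\<close> and a right descent \<open>t\<close>. The remaining \<open>v\<close> is lengthened by both generators,
  so keeps both simple roots positive, and the suffix maps \<open>\<alpha> s\<close> to a combination of them whose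
  Chebyshev coefficients are nonnegative because the suffix is reduced.
\<close>

lemma ascent_imp_positive:
  assumes "w \<in> W" "s \<in> S" "len w < len (w \<circ> s)"
  shows "w (\<alpha> s) \<in> simple_cone"
  using assms
proof (induction "len w" arbitrary: w s rule: less_induct)
  case less
  note w = less.prems(1) and s = less.prems(2) and asc = less.prems(3)
  show ?case
  proof (cases "w = id")
    case True
    then show ?thesis using s by (simp add: nonneg_cone_incl)
  next
    case False
    obtain xs where xs: "xs \<in> lists S" "length xs = len w" "word_map xs = w"
      using reduced_word[OF w] by blast
    have "xs \<noteq> []" using xs False by auto
    then obtain ys t where yt: "xs = ys @ [t]" by (metis rev_exhaust)
    have t: "t \<in> S" and ys: "ys \<in> lists S" using xs yt by auto
    have w_eq: "w = word_map ys \<circ> t" using xs yt by simp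
    have "w \<circ> t = word_map ys" unfolding w_eq comp_assoc gen_comp_gen[OF t] by simp
    then have desc: "len (w \<circ> t) < len w" using len_le[OF ys] xs(2) yt by simp
    with asc have st: "s \<noteq> t" by auto
    \<comment> \<open>\<open>Q j\<close>: some reduced expression of \<open>w\<close> ends in \<open>j\<close> alternating factors, the last being \<open>t\<close>\<close>
    define Q where "Q j \<longleftrightarrow> (\<exists>v\<in>W. w = v \<circ> alt_prod t s j \<and> len w = len v + j)" for j
    have "Q 1"
      unfolding Q_def
    proof (intro bexI conjI)
      show "w \<circ> t \<in> W" using w t by (simp add: comp_in_W gen_in_W)
      show "w = (w \<circ> t) \<circ> alt_prod t s 1"
        using gen_comp_gen[OF t] by (simp add: comp_assoc)
      show "len w = len (w \<circ> t) + 1" using len_comp_gen[OF w t] desc by auto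
    qed
    moreover have "j \<le> len w" if "Q j" for j using that by (auto simp: Q_def)
    ultimately obtain j where j: "Q j" "1 \<le> j" "\<And>i. Q i \<Longrightarrow> i \<le> j"
      using GreatestI_nat[of Q 1 "len w"] Greatest_le_nat[of Q _ "len w"] by blast
    then obtain v where v: "v \<in> W" "w = v \<circ> alt_prod t s j" "len w = len v + j"
      by (auto simp: Q_def)
    have last_ascent: "len v < len (v \<circ> r)" if r: "r = (if even (j - 1) then t else s)" for r
    proof -
      have rS: "r \<in> S" using r s t by simp
      have "alt_prod t s j = r \<circ> alt_prod t s (j - 1)"
        using alt_prod.simps(2)[of t s "j - 1"] j(2) r by simp
      then have "len w \<le> len (v \<circ> r) + len (alt_prod t s (j - 1))"
        using len_comp[OF comp_in_W[OF v(1) gen_in_W[OF rS]] alt_prod_in_W[OF t s]] v(2)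
        by (metis comp_assoc)
      also have "len (alt_prod t s (j - 1)) \<le> j - 1" by (rule len_alt_prod_le[OF t s])
      finally show ?thesis using v(3) j(2) by linarith
    qed
    have next_ascent: "len v < len (v \<circ> r)" if r: "r = (if even j then t else s)" for r
    proof (rule ccontr)
      have rS: "r \<in> S" using r s t by simp
      assume "\<not> ?thesis"
      then have "len v = len (v \<circ> r) + 1" using len_comp_gen[OF v(1) rS] by auto
      moreover have "w = (v \<circ> r) \<circ> alt_prod t s (Suc j)"
      proof -
        have "r \<circ> alt_prod t s (Suc j) = alt_prod t s j"
          unfolding alt_prod.simps r[symmetric] comp_assoc[symmetric] gen_comp_gen[OF rS] by simp
        then show ?thesis unfolding comp_assoc using v(2) by simp
      qed
      ultimately have "Q (Suc j)"
        unfolding Q_def using comp_in_W[OF v(1) gen_in_W[OF rS]] v(3) by auto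
      then show False using j(3) by fastforce
    qed
    have "len v < len (v \<circ> s)" "len v < len (v \<circ> t)"
      using last_ascent[OF refl] next_ascent[OF refl] j(2) by (auto split: if_splits)
    moreover have "len v < len w" using v(3) j(2) by simp
    ultimately have "v (\<alpha> s) \<in> simple_cone" "v (\<alpha> t) \<in> simple_cone"
      using less.hyps v(1) s t by blast+
    define u where "u = cheb (- B (\<alpha> s) (\<alpha> t))"
    have u_nonneg: "0 \<le> u (Suc j) \<and> 0 \<le> u j"
      using t s st[symmetric]
    proof (cases rule: dihedral_cases)
      case 1
      then show ?thesis unfolding u_def sym[of "\<alpha> s"] using cheb_nonneg_of_ge_1 by blast
    next
      case (2 m)
      have "j < m"
      proof (rule ccontr)
        assume "\<not> j < m"
        \<comment> \<open>then \<open>w s\<close> ends in an alternating product that is too long to be reduced\<close>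
        have ws: "w \<circ> s = v \<circ> alt_prod s t (Suc j)"
          unfolding v(2) alt_prod_Suc_right by (simp only: comp_assoc)
        have "len (w \<circ> s) \<le> len v + len (alt_prod s t (Suc j))"
          unfolding ws by (rule len_comp[OF v(1) alt_prod_in_W[OF s t]])
        moreover have "len (alt_prod s t (Suc j)) + 2 \<le> Suc j"
          by (rule len_alt_prod_not_reduced[OF s t]) (use 2 \<open>\<not> j < m\<close> in auto)
        ultimately show False using asc v(3) by linarith
      qed
      then show ?thesis
        unfolding u_def sym[of "\<alpha> s"] using cheb_nonneg_of_cos[of m] 2 by simp
    qed
    have "w (\<alpha> s) = v (alt_prod t s j (\<alpha> s))" using v(2) by (metis comp_apply)
    also have "\<dots> = u (Suc j) *\<^sub>R v (\<alpha> (if even j then s else t)) +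
        u j *\<^sub>R v (\<alpha> (if even j then t else s))"
      unfolding alt_prod_root[OF s t] u_def
      by (simp only: linear_add[OF W_linear[OF v(1)]] linear_scale[OF W_linear[OF v(1)]])
    also have "\<dots> \<in> simple_cone"
      by (intro nonneg_cone_add nonneg_cone_scale)
        (use u_nonneg \<open>v (\<alpha> s) \<in> simple_cone\<close> \<open>v (\<alpha> t) \<in> simple_cone\<close> in auto)
    finally show ?thesis .
  qed
qed

lemma root_pos_or_neg:
  assumes "b \<in> \<Phi>"
  shows "b \<in> simple_cone \<or> - b \<in> simple_cone"
proof -
  obtain w s where ws: "w \<in> W" "s \<in> S" "b = w (\<alpha> s)"
    using assms by (auto simp: roots_def)
  show ?thesis
  proof (cases "len w < len (w \<circ> s)")
    case True
    then show ?thesis using ascent_imp_positive ws by blast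
  next
    case False
    have "len (w \<circ> s) < len (w \<circ> s \<circ> s)"
      using len_comp_gen[OF ws(1,2)] False by (auto simp: comp_assoc gen_comp_gen[OF ws(2)])
    then have "(w \<circ> s) (\<alpha> s) \<in> simple_cone"
      using ascent_imp_positive[of "w \<circ> s" s] ws comp_in_W gen_in_W by blast
    then show ?thesis
      using ws by (simp add: gen_root linear_neg[OF W_linear])
  qed
qed

lemma root_norm_one: "b \<in> \<Phi> \<Longrightarrow> B b b = 1"
  by (auto simp: roots_def W_B root_norm)

lemma root_nonzero: "b \<in> \<Phi> \<Longrightarrow> b \<noteq> 0"
  using root_norm_one[of b] B_simps(5)[of 0 b b] by auto

lemma root_image:
  assumes "w \<in> W" "b \<in> \<Phi>"
  shows "w b \<in> \<Phi>"
proof -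
  obtain v a where v: "v \<in> W" "a \<in> \<Delta>" "b = v a" using assms(2) unfolding roots_def by blast
  then have "w b = (w \<circ> v) a" by simp
  then show ?thesis using v comp_in_W[OF assms(1) v(1)] unfolding roots_def by blast
qed

lemma simple_root: "s \<in> S \<Longrightarrow> \<alpha> s \<in> pos"
  unfolding pos_roots_def roots_def
  using id_in_W by (auto intro!: nonneg_cone_incl exI[of _ id])

lemma root_uminus:
  assumes "b \<in> \<Phi>"
  shows "- b \<in> \<Phi>"
proof -
  obtain w s where ws: "w \<in> W" "s \<in> S" "b = w (\<alpha> s)"
    using assms by (auto simp: roots_def)
  then have "- b = (w \<circ> s) (\<alpha> s)" by (simp add: gen_root linear_neg[OF W_linear])
  then show ?thesis
    using ws comp_in_W gen_in_W unfolding roots_def by blast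
qed

lemma pos_iff: "b \<in> pos \<longleftrightarrow> b \<in> \<Phi> \<and> b \<in> simple_cone"
  by (auto simp: pos_roots_def)

lemma root_pos_iff: "b \<in> \<Phi> \<Longrightarrow> - b \<in> pos \<longleftrightarrow> b \<notin> pos"
  using root_pos_or_neg[of b] root_uminus[of b] simple_cone_salient[of b] root_nonzero[of b]
  by (auto simp: pos_iff)

lemma root_multiple:
  assumes "a \<in> \<Phi>" "b \<in> \<Phi>" "b = p *\<^sub>R a" "0 \<le> p"
  shows "b = a"
proof -
  have "p * p = 1" using root_norm_one[OF assms(1)] root_norm_one[OF assms(2)] assms(3)
    by (simp add: B_simps)
  then have "p = 1" using assms(4) by (simp add: square_eq_1_iff)
  then show ?thesis using assms by simp
qed

lemma gen_pos:
  assumes "s \<in> S" "b \<in> pos" "b \<noteq> \<alpha> s"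
  shows "s b \<in> pos"
proof (rule ccontr)
  assume "s b \<notin> pos"
  have sb: "s b \<in> \<Phi>" using assms by (simp add: root_image gen_in_W pos_iff)
  with \<open>s b \<notin> pos\<close> have "- s b \<in> simple_cone" using root_pos_or_neg[OF sb] by (auto simp: pos_iff)
  moreover have "b + - s b = (2 * B (\<alpha> s) b) *\<^sub>R \<alpha> s"
    using gen_apply[OF assms(1), of b] by simp
  ultimately obtain p where "0 \<le> p" "b = p *\<^sub>R \<alpha> s"
    using simple_extreme[of "\<alpha> s" b "- s b"] assms by (auto simp: pos_iff)
  then show False
    using root_multiple[of "\<alpha> s" b p] assms simple_root[OF assms(1)] by (simp add: pos_iff)
qed

lemma gen_ne_root:
  assumes "s \<in> S" "b \<in> pos"
  shows "s b \<noteq> \<alpha> s"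
proof
  assume "s b = \<alpha> s"
  then have "b = - \<alpha> s" using gen_gen[OF assms(1), of b] gen_root[OF assms(1)] by simp
  then show False
    using assms(2) simple_root[OF assms(1)] root_pos_iff[of "\<alpha> s"] by (auto simp: pos_iff)
qed

section \<open>Finite biclosed sets are inversion sets\<close>

lemma inversions_iff:
  assumes "w \<in> W"
  shows "b \<in> inversions W \<Delta> w \<longleftrightarrow> b \<in> pos \<and> - inv_map w b \<in> pos"
proof -
  have "b \<in> w ` neg_roots W \<Delta> \<longleftrightarrow> - inv_map w b \<in> pos"
  proof
    assume "b \<in> w ` neg_roots W \<Delta>"
    then show "- inv_map w b \<in> pos"
      using W_bij[OF assms] by (auto simp: neg_roots_def bij_is_inj)
  next
    assume "- inv_map w b \<in> pos"
    then have "inv_map w b \<in> neg_roots W \<Delta>"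
      unfolding neg_roots_def by (metis add.inverse_inverse imageI)
    moreover have "w (inv_map w b) = b"
      using W_bij[OF assms] by (simp add: bij_is_surj surj_f_inv_f)
    ultimately show "b \<in> w ` neg_roots W \<Delta>" by (metis imageI)
  qed
  then show ?thesis by (auto simp: inversions_def)
qed

lemma closed_rootsD:
  assumes "closed_roots W \<Delta> A" "x \<in> A" "y \<in> A" "p *\<^sub>R x + q *\<^sub>R y \<in> \<Phi>" "0 \<le> p" "0 \<le> q"
  shows "p *\<^sub>R x + q *\<^sub>R y \<in> A"
proof -
  have "p *\<^sub>R x + q *\<^sub>R y \<in> nonneg_cone {x, y}"
    using assms(5,6) unfolding nonneg_cone_pair by blast
  then show ?thesis using assms(1-4) unfolding closed_roots_def by blast
qed

lemma closed_rootsI: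
  assumes "A \<subseteq> pos"
    and "\<And>x y p q. x \<in> A \<Longrightarrow> y \<in> A \<Longrightarrow> 0 \<le> p \<Longrightarrow> 0 \<le> q \<Longrightarrow>
      p *\<^sub>R x + q *\<^sub>R y \<in> \<Phi> \<Longrightarrow> p *\<^sub>R x + q *\<^sub>R y \<in> pos \<Longrightarrow> p *\<^sub>R x + q *\<^sub>R y \<in> A"
  shows "closed_roots W \<Delta> A"
  unfolding closed_roots_def
proof (intro conjI ballI subsetI)
  fix x y z assume xy: "x \<in> A" "y \<in> A" and z: "z \<in> nonneg_cone {x, y} \<inter> \<Phi>"
  then obtain p q where pq: "0 \<le> p" "0 \<le> q" "z = p *\<^sub>R x + q *\<^sub>R y"
    unfolding Int_iff nonneg_cone_pair by blast
  then have "z \<in> simple_cone"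
    using xy assms(1) by (auto simp: pos_iff intro!: nonneg_cone_add nonneg_cone_scale)
  then show "z \<in> A" using assms(2)[OF xy pq(1,2)] z pq(3) by (simp add: pos_iff)
qed (use assms(1) in blast)

lemma simple_indecomposable:
  assumes "s \<in> S" "x \<in> pos" "y \<in> pos" "0 \<le> p" "0 \<le> q" "p *\<^sub>R x + q *\<^sub>R y = \<alpha> s"
  shows "x = \<alpha> s \<or> y = \<alpha> s"
proof -
  have zero: "p = 0" if x: "x \<in> pos" "x \<noteq> \<alpha> s" and y: "y \<in> pos"
    and pq: "0 \<le> p" "0 \<le> q" and sum: "p *\<^sub>R x + q *\<^sub>R y = \<alpha> s" for x y p q
  proof (rule ccontr)
    assume "p \<noteq> 0"
    have "p *\<^sub>R x \<in> simple_cone" "q *\<^sub>R y \<in> simple_cone"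
      using x y pq by (auto simp: pos_iff intro: nonneg_cone_scale)
    then obtain r where r: "0 \<le> r" "p *\<^sub>R x = r *\<^sub>R \<alpha> s"
      using simple_extreme[of "\<alpha> s" "p *\<^sub>R x" "q *\<^sub>R y" 1] assms(1) sum by auto
    then have "x = (r / p) *\<^sub>R \<alpha> s"
      using \<open>p \<noteq> 0\<close> by (metis divide_inverse_commute scaleR_one scaleR_scaleR left_inverse)
    then show False
      using root_multiple[of "\<alpha> s" x "r / p"] simple_root[OF assms(1)] x r(1) pq(1)
      by (simp add: pos_iff)
  qed
  show ?thesis
  proof (rule ccontr)
    assume "\<not> ?thesis"
    then have "p = 0" "q = 0"
      using zero[of x y p q] zero[of y x q p] assms by (simp_all add: add.commute)
    then show False
      using assms(6) root_nonzero[of "\<alpha> s"] simple_root[OF assms(1)] by (simp add: pos_iff)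
  qed
qed

text \<open>
  A root of \<open>A\<close> on which a functional positive on all positive roots is minimal: if it is not
  simple, reflecting it in a simple root \<open>\<delta>\<close> with which it has positive product decreases the
  functional and hence leaves \<open>A\<close>; as the complement of \<open>A\<close> is closed, \<open>\<delta>\<close> lies in \<open>A\<close>.
\<close>

lemma biclosed_contains_simple:
  assumes "biclosed_roots W \<Delta> A" "finite A" "A \<noteq> {}" and pos: "\<And>b. b \<in> pos \<Longrightarrow> 0 < a \<bullet> b"
  shows "\<exists>s\<in>S. \<alpha> s \<in> A"
proof -
  have sub: "A \<subseteq> pos" and co: "closed_roots W \<Delta> (pos - A)"
    using assms(1) by (auto simp: biclosed_roots_def)
  obtain b where "is_arg_min ((\<bullet>) a) (\<lambda>x. x \<in> A) b"
    using ex_is_arg_min_if_finite[OF assms(2,3)] by blast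
  then have b: "b \<in> A" "\<And>x. x \<in> A \<Longrightarrow> a \<bullet> b \<le> a \<bullet> x"
    by (auto simp: is_arg_min_linorder)
  then have bpos: "b \<in> \<Phi>" "b \<in> simple_cone" "b \<in> pos" using sub by (auto simp: pos_iff)
  then obtain c where c: "\<forall>x\<in>\<Delta>. 0 \<le> c x" "b = (\<Sum>x\<in>\<Delta>. c x *\<^sub>R x)"
    using nonneg_cone_finite[OF finite_simple] by blast
  have "(\<Sum>x\<in>\<Delta>. c x * B b x) = 1"
    using B_sum_right[of b c \<Delta>] c(2) root_norm_one[OF bpos(1)] by simp
  then have "\<not> (\<forall>x\<in>\<Delta>. c x * B b x \<le> 0)"
    using sum_nonpos[of \<Delta> "\<lambda>x. c x * B b x"] by auto
  then obtain s where s: "s \<in> S" "0 < c (\<alpha> s) * B b (\<alpha> s)" by auto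
  then have prod: "0 < B (\<alpha> s) b"
    using c(1) sym[of b "\<alpha> s"] by (auto simp: zero_less_mult_iff)
  show ?thesis
  proof (cases "b = \<alpha> s")
    case True
    with b s show ?thesis by auto
  next
    case False
    have sb: "s b = b - (2 * B (\<alpha> s) b) *\<^sub>R \<alpha> s" by (rule gen_apply[OF s(1)])
    have sbpos: "s b \<in> pos" using gen_pos[OF s(1) bpos(3) False] .
    have "a \<bullet> s b < a \<bullet> b"
      unfolding sb using prod pos[OF simple_root[OF s(1)]] by (simp add: inner_diff_right)
    then have "s b \<in> pos - A" using b(2)[of "s b"] sbpos by auto
    moreover have eq: "1 *\<^sub>R s b + (2 * B (\<alpha> s) b) *\<^sub>R \<alpha> s = b" unfolding sb by simp
    ultimately have "b \<in> pos - A" if "\<alpha> s \<in> pos - A"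
      using closed_rootsD[OF co _ that, of "s b" 1 "2 * B (\<alpha> s) b"] prod bpos(1)
      unfolding eq by simp
    then show ?thesis using b(1) simple_root[OF s(1)] s(1) by blast
  qed
qed

lemma gen_image_iff: "s \<in> S \<Longrightarrow> b \<in> s ` A \<longleftrightarrow> s b \<in> A"
  by (metis gen_gen image_iff)

lemma gen_linear: "s \<in> S \<Longrightarrow> s (p *\<^sub>R x + q *\<^sub>R y) = p *\<^sub>R s x + q *\<^sub>R s y"
  using W_linear[OF gen_in_W, of s] by (simp add: linear_add linear_scale)

text \<open>
  As \<open>s\<close> permutes the positive roots other than \<open>\<alpha> s\<close>, both closure conditions transport along \<open>s\<close>
  except where \<open>\<alpha> s\<close> itself is involved. On the side of \<open>A\<close> it cannot be, as \<open>\<alpha> s\<close> is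
  indecomposable. On the other side, a combination of \<open>\<alpha> s\<close> and \<open>y\<close> that lands in the reflected set
  would exhibit \<open>s y\<close> as a combination of two elements of \<open>A\<close>.
\<close>

lemma biclosed_reflect:
  assumes "biclosed_roots W \<Delta> A" "s \<in> S" "\<alpha> s \<in> A"
  shows "biclosed_roots W \<Delta> (s ` (A - {\<alpha> s}))" (is "biclosed_roots W \<Delta> ?A'")
proof -
  have sub: "A \<subseteq> pos" and cl: "closed_roots W \<Delta> A" and co: "closed_roots W \<Delta> (pos - A)"
    using assms(1) by (auto simp: biclosed_roots_def)
  have sub': "?A' \<subseteq> pos" using sub gen_pos[OF assms(2)] by blast
  have mem: "b \<in> ?A' \<longleftrightarrow> s b \<in> A \<and> s b \<noteq> \<alpha> s" for b
    using gen_image_iff[OF assms(2)] by simp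
  have root: "s b \<in> \<Phi>" if "b \<in> \<Phi>" for b using that assms(2) by (simp add: root_image gen_in_W)
  have "closed_roots W \<Delta> ?A'"
  proof (rule closed_rootsI[OF sub'])
    fix x y p q
    assume xy: "x \<in> ?A'" "y \<in> ?A'" and pq: "(0::real) \<le> p" "(0::real) \<le> q"
      and z: "p *\<^sub>R x + q *\<^sub>R y \<in> \<Phi>"
    have "p *\<^sub>R s x + q *\<^sub>R s y \<in> A"
      by (rule closed_rootsD[OF cl]) (use xy pq root[OF z] in \<open>auto simp: mem gen_linear[OF assms(2)]\<close>)
    moreover have "p *\<^sub>R s x + q *\<^sub>R s y \<noteq> \<alpha> s"
      using simple_indecomposable[OF assms(2), of "s x" "s y" p q] xy pq sub by (auto simp: mem)
    ultimately show "p *\<^sub>R x + q *\<^sub>R y \<in> ?A'" by (simp add: mem gen_linear[OF assms(2)])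
  qed
  moreover have "closed_roots W \<Delta> (pos - ?A')"
  proof (rule closed_rootsI)
    have refl: "s x \<in> pos - A" if "x \<in> pos - ?A'" "x \<noteq> \<alpha> s" for x
      using that gen_pos[OF assms(2)] gen_ne_root[OF assms(2)] mem by blast
    have notin: "\<alpha> s \<notin> ?A'" using sub gen_ne_root[OF assms(2)] by fastforce
    have mixed: False if y: "y \<in> pos - ?A'" "y \<noteq> \<alpha> s" and pq: "0 \<le> p" "0 \<le> q"
      and z: "p *\<^sub>R \<alpha> s + q *\<^sub>R y \<in> ?A'" for y p q
    proof -
      have zroot: "p *\<^sub>R \<alpha> s + q *\<^sub>R y \<in> \<Phi>" "p *\<^sub>R \<alpha> s + q *\<^sub>R y \<noteq> \<alpha> s"
        using z sub' notin by (auto simp: pos_iff)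
      have "q \<noteq> 0"
        using root_multiple[of "\<alpha> s" _ p] zroot simple_root[OF assms(2)] pq by (auto simp: pos_iff)
      have sz: "s (p *\<^sub>R \<alpha> s + q *\<^sub>R y) = q *\<^sub>R s y - p *\<^sub>R \<alpha> s"
        by (simp add: gen_linear[OF assms(2)] gen_root[OF assms(2)])
      have eq: "(1 / q) *\<^sub>R (q *\<^sub>R s y - p *\<^sub>R \<alpha> s) + (p / q) *\<^sub>R \<alpha> s = s y"
        using \<open>q \<noteq> 0\<close> by (simp add: scaleR_diff_right)
      have "(1 / q) *\<^sub>R (q *\<^sub>R s y - p *\<^sub>R \<alpha> s) + (p / q) *\<^sub>R \<alpha> s \<in> A"
      proof (rule closed_rootsD[OF cl _ assms(3)])
        show "q *\<^sub>R s y - p *\<^sub>R \<alpha> s \<in> A" using z unfolding mem sz by simp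
        show "(1 / q) *\<^sub>R (q *\<^sub>R s y - p *\<^sub>R \<alpha> s) + (p / q) *\<^sub>R \<alpha> s \<in> \<Phi>"
          unfolding eq using y(1) root by (simp add: pos_iff)
      qed (use pq in auto)
      then show False using refl[OF y] unfolding eq by simp
    qed
    fix x y p q
    assume x: "x \<in> pos - ?A'" and y: "y \<in> pos - ?A'" and pq: "(0::real) \<le> p" "(0::real) \<le> q"
      and z: "p *\<^sub>R x + q *\<^sub>R y \<in> \<Phi>" "p *\<^sub>R x + q *\<^sub>R y \<in> pos"
    have "p *\<^sub>R x + q *\<^sub>R y \<notin> ?A'"
    proof
      assume zA: "p *\<^sub>R x + q *\<^sub>R y \<in> ?A'"
      consider "x \<noteq> \<alpha> s" "y \<noteq> \<alpha> s" | "x = \<alpha> s" "y = \<alpha> s" | "x = \<alpha> s" "y \<noteq> \<alpha> s" | "x \<noteq> \<alpha> s" "y = \<alpha> s"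
        by blast
      then show False
      proof cases
        case 1
        have "p *\<^sub>R s x + q *\<^sub>R s y \<in> pos - A"
          by (rule closed_rootsD[OF co refl[OF x 1(1)] refl[OF y 1(2)] _ pq])
            (use root[OF z(1)] gen_linear[OF assms(2)] in simp)
        then show False using zA gen_linear[OF assms(2)] by (simp add: mem)
      next
        case 2
        have "p *\<^sub>R x + q *\<^sub>R y = (p + q) *\<^sub>R \<alpha> s" using 2 by (simp add: scaleR_add_left)
        then have "p *\<^sub>R x + q *\<^sub>R y = \<alpha> s"
          using root_multiple[of "\<alpha> s" "p *\<^sub>R x + q *\<^sub>R y" "p + q"] simple_root[OF assms(2)] z(1) pq
          by (simp add: pos_iff)
        then show False using zA notin by simp
      next
        case 3
        then show False using mixed[OF y 3(2) pq] zA by simp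
      next
        case 4
        then show False using mixed[OF x 4(1) pq(2,1)] zA by (simp add: add.commute)
      qed
    qed
    then show "p *\<^sub>R x + q *\<^sub>R y \<in> pos - ?A'" using z by blast
  qed blast
  ultimately show ?thesis using sub' by (simp add: biclosed_roots_def)
qed

lemma inv_map_comp_gen:
  assumes "s \<in> S" "w \<in> W"
  shows "inv_map (s \<circ> w) b = inv_map w (s b)"
proof -
  have "bij s" using W_bij[OF gen_in_W[OF assms(1)]] .
  then have "inv_map s b = s b" using gen_gen[OF assms(1)] by (metis bij_is_inj inv_f_f)
  then show ?thesis using o_inv_distrib[OF \<open>bij s\<close> W_bij[OF assms(2)]] by simp
qed

text \<open>
  Induction on the cardinality: a nonempty finite biclosed set contains a simple root \<open>\<alpha> s\<close>, and
  removing it and reflecting by \<open>s\<close> gives a smaller biclosed set \<open>N(w)\<close>; then \<open>s w\<close> works.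
\<close>

lemma finite_biclosed_is_inversions:
  assumes pos: "\<And>b. b \<in> pos \<Longrightarrow> 0 < a \<bullet> b"
    and "biclosed_roots W \<Delta> A" "finite A"
  shows "\<exists>w\<in>W. A = inversions W \<Delta> w"
  using assms(2,3)
proof (induction "card A" arbitrary: A rule: less_induct)
  case less
  show ?case
  proof (cases "A = {}")
    case True
    have "b \<notin> inversions W \<Delta> id" for b
      unfolding inversions_iff[OF id_in_W] using root_pos_iff[of b] by (auto simp: pos_iff)
    then show ?thesis using True id_in_W by blast
  next
    case False
    obtain s where s: "s \<in> S" "\<alpha> s \<in> A"
      using biclosed_contains_simple[OF less.prems False pos] by blast
    let ?A' = "s ` (A - {\<alpha> s})"
    have sub: "A \<subseteq> pos" using less.prems by (simp add: biclosed_roots_def)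
    have "card ?A' < card A"
      using card_image_le[of "A - {\<alpha> s}" s] card_Diff1_less[OF less.prems(2) s(2)] less.prems(2)
      by simp
    then obtain w where w: "w \<in> W" "?A' = inversions W \<Delta> w"
      using less.hyps biclosed_reflect[OF less.prems(1) s] less.prems(2) by blast
    have sw: "s \<circ> w \<in> W" using s w comp_in_W gen_in_W by blast
    have "b \<in> A \<longleftrightarrow> b \<in> pos \<and> - inv_map w (s b) \<in> pos" for b
    proof (cases "b = \<alpha> s")
      case True
      have "inv_map w b \<in> \<Phi>"
        using root_image[OF inv_in_W[OF w(1)]] simple_root[OF s(1)] True by (simp add: pos_iff)
      moreover have "b \<notin> inversions W \<Delta> w"
        unfolding w(2)[symmetric] True using gen_ne_root[OF s(1)] sub by fastforce
      ultimately have "inv_map w b \<in> pos"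
        using inversions_iff[OF w(1)] simple_root[OF s(1)] True root_pos_iff by blast
      then show ?thesis
        using True s simple_root[OF s(1)]
        by (simp add: gen_root[OF s(1)] linear_neg[OF W_linear[OF inv_in_W[OF w(1)]]])
    next
      case False
      have "b \<in> A \<longleftrightarrow> s b \<in> inversions W \<Delta> w"
        unfolding w(2)[symmetric] gen_image_iff[OF s(1)] gen_gen[OF s(1)] using False by simp
      then show ?thesis
        unfolding inversions_iff[OF w(1)] using sub gen_pos[OF s(1) _ False] by blast
    qed
    then have "A = inversions W \<Delta> (s \<circ> w)"
      using inversions_iff[OF sw] inv_map_comp_gen[OF s(1) w(1)] by auto
    then show ?thesis using sw by blast
  qed
qed

section \<open>Half-spaces and limit roots\<close>

text \<open>The central projection to the affine hyperplane on which \<open>a\<close> takes the value \<open>1\<close>.\<close>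

definition rescale :: "'a \<Rightarrow> 'a \<Rightarrow> 'a" where
  "rescale a b = (1 / (a \<bullet> b)) *\<^sub>R b"

text \<open>
  If there are roots, a transverse hyperplane misses the origin, so it is the level set at \<open>1\<close> of a
  functional positive on the positive roots, and normalization is the corresponding rescaling.
  Without roots it may pass through the origin, but then there are no limit roots either, and its
  normal vector serves as \<open>a\<close>.
\<close>

lemma transverse_functional:
  assumes "transverse X pos"
  obtains a where "a \<noteq> 0" "\<And>b. b \<in> pos \<Longrightarrow> 0 < a \<bullet> b"
    "limit_roots W \<Delta> X = {x. x islimpt rescale a ` pos}"
proof -
  have aff: "affine X" "aff_dim X = int DIM('a) - 1"
    and unique: "\<And>b. b \<in> pos \<Longrightarrow> \<exists>!p. p \<in> ray b \<inter> X \<and> p \<noteq> 0"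
    using assms by (auto simp: transverse_def affine_hyperplane_def)
  have "affine hull X = X" using aff(1) by (simp add: affine_hull_eq)
  moreover have "aff_dim X = int (DIM('a) - 1)"
    using aff(2) DIM_positive[where 'a='a] by (simp add: of_nat_diff Suc_leI)
  ultimately obtain a0 c0 where a0: "a0 \<noteq> 0" "X = {x. a0 \<bullet> x = c0}"
    using aff_dim_eq_hyperplane[of X] by (simp only:) blast
  have "closed X" unfolding a0(2) by (rule closed_hyperplane)
  have "\<exists>a. a \<noteq> 0 \<and> (\<forall>b\<in>pos. 0 < a \<bullet> b \<and> (THE p. p \<in> ray b \<inter> X \<and> p \<noteq> 0) = rescale a b)"
  proof (cases "c0 = 0")
    case True
    \<comment> \<open>a hyperplane through the origin contains no unique multiple of a root: there are no roots\<close>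
    have "pos = {}"
    proof (rule ccontr)
      assume "pos \<noteq> {}"
      then obtain b where b: "b \<in> pos" by blast
      obtain p where p: "p \<in> ray b \<inter> X" "p \<noteq> 0" using unique[OF b] by blast
      then obtain c where c: "0 \<le> c" "p = c *\<^sub>R b" by (auto simp: ray_def)
      have "2 *\<^sub>R p \<in> ray b"
        unfolding ray_def using c by (intro CollectI exI[of _ "2 * c"]) simp
      then have "2 *\<^sub>R p \<in> ray b \<inter> X \<and> 2 *\<^sub>R p \<noteq> 0" using p True a0(2) by auto
      then have "2 *\<^sub>R p = p" using unique[OF b] p by blast
      then show False using p by (simp add: scaleR_2)
    qed
    then show ?thesis using a0(1) by blast
  next
    case False
    define a where "a = (1 / c0) *\<^sub>R a0"
    have a: "a \<noteq> 0" "X = {x. a \<bullet> x = 1}" using a0 False by (auto simp: a_def field_simps)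
    have "0 < a \<bullet> b \<and> (THE p. p \<in> ray b \<inter> X \<and> p \<noteq> 0) = rescale a b" if b: "b \<in> pos" for b
    proof -
      obtain p where p: "p \<in> ray b \<inter> X" "p \<noteq> 0" using unique[OF b] by blast
      then obtain c where c: "0 \<le> c" "p = c *\<^sub>R b" by (auto simp: ray_def)
      then have "c * (a \<bullet> b) = 1" using p a by auto
      then have ab: "0 < a \<bullet> b" using c(1) by (metis zero_less_mult_iff zero_less_one not_less)
      have "rescale a b \<in> ray b \<inter> X \<and> rescale a b \<noteq> 0"
        unfolding rescale_def ray_def a(2)
        using ab by (auto intro!: exI[of _ "1 / (a \<bullet> b)"])
      with ab show ?thesis using the1_equality[OF unique[OF b]] by blast
    qed
    with a(1) show ?thesis by blast
  qed
  then obtain a where a: "a \<noteq> 0" "\<And>b. b \<in> pos \<Longrightarrow> 0 < a \<bullet> b"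
    "\<And>b. b \<in> pos \<Longrightarrow> (THE p. p \<in> ray b \<inter> X \<and> p \<noteq> 0) = rescale a b"
    by blast
  have image: "normalized_root W \<Delta> X ` \<Phi> = rescale a ` pos"
  proof (intro subset_antisym subsetI)
    fix y assume "y \<in> normalized_root W \<Delta> X ` \<Phi>"
    then obtain b where b: "b \<in> \<Phi>" "y = normalized_root W \<Delta> X b" by blast
    then show "y \<in> rescale a ` pos"
      using root_pos_iff[OF b(1)] a(3)[of b] a(3)[of "- b"] by (auto simp: normalized_root_def)
  next
    fix y assume "y \<in> rescale a ` pos"
    then obtain b where b: "b \<in> pos" "y = rescale a b" by blast
    then have "y = normalized_root W \<Delta> X b" using a(3) by (simp add: normalized_root_def)
    then show "y \<in> normalized_root W \<Delta> X ` \<Phi>" using b(1) unfolding pos_iff by (metis imageI)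
  qed
  have "rescale a ` pos \<subseteq> X"
  proof
    fix y assume "y \<in> rescale a ` pos"
    then obtain b where b: "b \<in> pos" "y = rescale a b" by blast
    show "y \<in> X" using theI'[OF unique[OF b(1)]] a(3)[OF b(1)] b(2) by simp
  qed
  then have "x \<in> X" if "x islimpt rescale a ` pos" for x
    using islimpt_subset[OF that] \<open>closed X\<close> unfolding closed_limpt by blast
  then have "limit_roots W \<Delta> X = {x. x islimpt rescale a ` pos}"
    unfolding limit_roots_def image by blast
  with a(1,2) show ?thesis using that by blast
qed

text \<open>
  On the cone over the simple roots, a functional positive on them dominates the norm. This bounds
  the normalized roots and, being a closed condition, it also holds at their limits, where it
  turns a nonzero vector into a positive value of the functional.
\<close>

lemma norm_le_functional:
  assumes pos: "\<And>b. b \<in> pos \<Longrightarrow> 0 < a \<bullet> b"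
  obtains M where "0 \<le> M" "\<And>x. x \<in> simple_cone \<Longrightarrow> norm x \<le> M * (a \<bullet> x)"
proof
  let ?M = "\<Sum>d\<in>\<Delta>. norm d / (a \<bullet> d)"
  have pos\<Delta>: "0 < a \<bullet> d" if "d \<in> \<Delta>" for d using that pos simple_root by auto
  show "0 \<le> ?M" by (rule sum_nonneg) (use pos\<Delta> in \<open>simp add: less_imp_le\<close>)
  fix x assume "x \<in> simple_cone"
  then obtain c where c: "\<forall>d\<in>\<Delta>. 0 \<le> c d" "x = (\<Sum>d\<in>\<Delta>. c d *\<^sub>R d)"
    using nonneg_cone_finite[OF finite_simple] by blast
  have "norm x \<le> (\<Sum>d\<in>\<Delta>. norm (c d *\<^sub>R d))" unfolding c(2) by (rule norm_sum)
  also have "\<dots> \<le> (\<Sum>d\<in>\<Delta>. (c d * (a \<bullet> d)) * ?M)"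
  proof (rule sum_mono)
    fix d assume d: "d \<in> \<Delta>"
    have "norm d / (a \<bullet> d) \<le> ?M"
      by (rule member_le_sum[OF d _ finite_simple]) (use pos\<Delta> in \<open>simp add: less_imp_le\<close>)
    then have "(c d * (a \<bullet> d)) * (norm d / (a \<bullet> d)) \<le> (c d * (a \<bullet> d)) * ?M"
      by (intro mult_left_mono) (use c(1) d pos\<Delta>[OF d] in auto)
    then show "norm (c d *\<^sub>R d) \<le> (c d * (a \<bullet> d)) * ?M" using bspec[OF c(1) d] pos\<Delta>[OF d] by simp
  qed
  also have "\<dots> = ?M * (a \<bullet> x)"
    unfolding c(2) inner_sum_right by (simp add: sum_distrib_right mult.commute)
  finally show "norm x \<le> ?M * (a \<bullet> x)" .
qed

lemma rescale_in_cone: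
  assumes "b \<in> pos" "0 < a \<bullet> b"
  shows "rescale a b \<in> simple_cone" "a \<bullet> rescale a b = 1"
  using assms by (auto simp: rescale_def pos_iff intro!: nonneg_cone_scale)

lemma finite_pos_roots_in_half_space:
  assumes pos: "\<And>b. b \<in> pos \<Longrightarrow> 0 < a \<bullet> b"
    and f: "linear f" "\<And>x. x islimpt rescale a ` pos \<Longrightarrow> f x < (0::real)"
  shows "finite {b \<in> pos. 0 < f b}" (is "finite ?A")
proof (rule ccontr)
  assume "infinite ?A"
  have inj: "inj_on (rescale a) ?A"
  proof (rule inj_onI)
    fix x y assume xy: "x \<in> ?A" "y \<in> ?A" "rescale a x = rescale a y"
    then have ax: "0 < a \<bullet> x" "0 < a \<bullet> y" using pos by auto
    have "y = (a \<bullet> y) *\<^sub>R rescale a y" using ax by (simp add: rescale_def)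
    also have "\<dots> = ((a \<bullet> y) / (a \<bullet> x)) *\<^sub>R x" unfolding xy(3)[symmetric] by (simp add: rescale_def)
    finally show "x = y"
      using root_multiple[of x y "(a \<bullet> y) / (a \<bullet> x)"] xy(1,2) ax by (simp add: pos_iff)
  qed
  obtain M where M: "0 \<le> M" "\<And>x. x \<in> simple_cone \<Longrightarrow> norm x \<le> M * (a \<bullet> x)"
    using norm_le_functional[OF pos] by blast
  have "norm x \<le> M" if "x \<in> rescale a ` ?A" for x
    using that M(2) rescale_in_cone pos by fastforce
  then have "bounded (rescale a ` ?A)" by (auto simp: bounded_iff)
  moreover have "infinite (rescale a ` ?A)" using \<open>infinite ?A\<close> inj finite_imageD by blast
  ultimately obtain x where x: "x islimpt rescale a ` ?A"
    using bounded_infinite_imp_islimpt by blast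
  have "x islimpt rescale a ` pos" by (rule islimpt_subset[OF x]) auto
  then have "f x < 0" by (rule f)
  have "continuous_on UNIV f"
    using f(1) by (simp add: linear_continuous_on linear_conv_bounded_linear)
  then have "closed {x. 0 \<le> f x}" by (intro closed_Collect_le continuous_on_const)
  moreover have "rescale a ` ?A \<subseteq> {x. 0 \<le> f x}"
    using pos by (auto simp: rescale_def linear_scale[OF f(1)] less_imp_le)
  ultimately have "x \<in> {x. 0 \<le> f x}"
    using islimpt_subset[OF x] unfolding closed_limpt by blast
  then show False using \<open>f x < 0\<close> by simp
qed

lemma biclosed_half_space:
  assumes f: "linear f"
  shows "biclosed_roots W \<Delta> {b \<in> pos. 0 < (f b :: real)}" (is "biclosed_roots W \<Delta> ?A")
proof -
  have f_comb: "f (p *\<^sub>R x + q *\<^sub>R y) = p * f x + q * f y" for p q x y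
    by (simp add: linear_add[OF f] linear_scale[OF f])
  have "closed_roots W \<Delta> ?A"
  proof (rule closed_rootsI)
    fix x y p q
    assume xy: "x \<in> ?A" "y \<in> ?A" and pq: "(0::real) \<le> p" "(0::real) \<le> q"
      and z: "p *\<^sub>R x + q *\<^sub>R y \<in> \<Phi>" "p *\<^sub>R x + q *\<^sub>R y \<in> pos"
    have "0 < p \<or> 0 < q" using root_nonzero[OF z(1)] pq by (auto simp: less_le)
    then have "0 < p * f x + q * f y"
      using xy pq by (auto intro: add_pos_nonneg add_nonneg_pos)
    then show "p *\<^sub>R x + q *\<^sub>R y \<in> ?A" using z by (simp add: f_comb)
  qed auto
  moreover have "closed_roots W \<Delta> (pos - ?A)"
  proof (rule closed_rootsI)
    fix x y p q
    assume xy: "x \<in> pos - ?A" "y \<in> pos - ?A" and pq: "(0::real) \<le> p" "(0::real) \<le> q"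
      and z: "p *\<^sub>R x + q *\<^sub>R y \<in> pos"
    have "p * f x + q * f y \<le> 0"
      using xy pq by (auto intro!: add_nonpos_nonpos mult_nonneg_nonpos)
    then show "p *\<^sub>R x + q *\<^sub>R y \<in> pos - ?A" using z by (simp add: f_comb)
  qed auto
  ultimately show ?thesis by (auto simp: biclosed_roots_def)
qed

text \<open>
  Apart from the finitely many roots in \<open>N(w)\<close>, the map \<open>w\<inverse>\<close> sends positive roots to positive
  roots. Hence the estimate of \<open>norm_le_functional\<close> holds for the images under \<open>w\<inverse>\<close> of all but
  finitely many normalized roots, and so for the images of the limit roots, which are nonzero.
\<close>

lemma limit_root_positive:
  assumes pos: "\<And>b. b \<in> pos \<Longrightarrow> 0 < a \<bullet> b"
    and w: "w \<in> W" "finite (inversions W \<Delta> w)" and x: "x islimpt rescale a ` pos"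
  shows "0 < a \<bullet> inv_map w x"
proof -
  let ?w' = "inv_map w"
  have lin: "linear ?w'" using W_linear[OF inv_in_W[OF w(1)]] .
  obtain M where M: "0 \<le> M" "\<And>x. x \<in> simple_cone \<Longrightarrow> norm x \<le> M * (a \<bullet> x)"
    using norm_le_functional[OF pos] by blast
  let ?T = "{v. norm (?w' v) \<le> M * (a \<bullet> ?w' v)}"
  have "rescale a b \<in> ?T" if b: "b \<in> pos" "b \<notin> inversions W \<Delta> w" for b
  proof -
    have "?w' b \<in> \<Phi>" using b root_image[OF inv_in_W[OF w(1)]] by (simp add: pos_iff)
    then have "?w' b \<in> pos" using b inversions_iff[OF w(1)] root_pos_iff by blast
    then have "?w' (rescale a b) \<in> simple_cone"
      using pos[OF b(1)]
      by (auto simp: rescale_def linear_scale[OF lin] pos_iff intro!: nonneg_cone_scale)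
    then show ?thesis using M(2) by simp
  qed
  then have "rescale a ` pos \<subseteq> rescale a ` inversions W \<Delta> w \<union> ?T" by blast
  then have "x islimpt ?T"
    using islimpt_subset[OF x] islimpt_finite[OF finite_imageI[OF w(2)]] islimpt_Un by blast
  moreover have "closed ?T"
  proof -
    have "continuous_on UNIV ?w'"
      using lin by (simp add: linear_continuous_on linear_conv_bounded_linear)
    then show ?thesis by (intro closed_Collect_le continuous_intros)
  qed
  ultimately have le: "norm (?w' x) \<le> M * (a \<bullet> ?w' x)" by (auto simp: closed_limpt)
  have "rescale a ` pos \<subseteq> {x. a \<bullet> x = 1}" using rescale_in_cone pos by auto
  then have "x \<in> {x. a \<bullet> x = 1}"
    using islimpt_subset[OF x] closed_hyperplane[of a 1] unfolding closed_limpt by blast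
  then have "x \<noteq> 0" by auto
  moreover have "w (?w' x) = x" using W_bij[OF w(1)] by (simp add: bij_is_surj surj_f_inv_f)
  ultimately have "?w' x \<noteq> 0" using linear_0[OF W_linear[OF w(1)]] by metis
  then have "0 < M * (a \<bullet> ?w' x)" using le by (metis zero_less_norm_iff less_le_trans)
  then show ?thesis using M(1) by (auto simp: zero_less_mult_iff)
qed

text \<open>
  The half-space is the preimage under \<open>w\<inverse>\<close> of the side where a functional positive on \<open>\<Phi>\<^sup>+\<close>
  is negative.
\<close>

lemma inversions_half_space:
  assumes a: "a \<noteq> 0" and pos: "\<And>b. b \<in> pos \<Longrightarrow> 0 < a \<bullet> b"
    and w: "w \<in> W" "finite (inversions W \<Delta> w)"
  obtains g where "g \<noteq> 0" "inversions W \<Delta> w = {b \<in> pos. g \<bullet> b < 0}"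
    "\<And>x. x islimpt rescale a ` pos \<Longrightarrow> 0 < g \<bullet> x"
proof
  let ?w' = "inv_map w"
  let ?g = "adjoint ?w' a"
  have lin: "linear ?w'" using W_linear[OF inv_in_W[OF w(1)]] .
  have g: "?g \<bullet> x = a \<bullet> ?w' x" for x
    using adjoint_works[OF lin, of x a] by (simp add: inner_commute)
  have "?w' (w a) = a" using W_bij[OF w(1)] by (simp add: bij_is_inj)
  then have "?g \<bullet> w a \<noteq> 0" unfolding g using a by simp
  then show "?g \<noteq> 0" by auto
  show "0 < ?g \<bullet> x" if "x islimpt rescale a ` pos" for x
    unfolding g using limit_root_positive[OF pos w that] .
  have "- ?w' b \<in> pos \<longleftrightarrow> a \<bullet> ?w' b < 0" if b: "b \<in> pos" for b
  proof -
    have r: "?w' b \<in> \<Phi>" using b root_image[OF inv_in_W[OF w(1)]] by (simp add: pos_iff)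
    show ?thesis
      using root_pos_iff[OF r] pos[of "?w' b"] pos[of "- ?w' b"] by fastforce
  qed
  then show "inversions W \<Delta> w = {b \<in> pos. ?g \<bullet> b < 0}"
    unfolding g using inversions_iff[OF w(1)] by blast
qed

end

theorem corollary3p4:
  fixes B :: "'a::euclidean_space \<Rightarrow> 'a \<Rightarrow> real"
    and W S :: "('a \<Rightarrow> 'a) set"
    and \<alpha> :: "('a \<Rightarrow> 'a) \<Rightarrow> 'a"
    and \<Delta> V\<^sub>1 :: "'a set"
  assumes "bilinear B" and "\<And>x y. B x y = B y x"
    and "geometric_coxeter_system B W S \<alpha>"
    and "\<Delta> = \<alpha> ` S"
    and "transverse V\<^sub>1 (pos_roots W \<Delta>)"
  shows "(\<forall>H P. linear_hyperplane H \<and> H \<inter> imaginary_convex_body W \<Delta> V\<^sub>1 = {} \<and>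
              open_half_space H P \<and> P \<inter> imaginary_convex_body W \<Delta> V\<^sub>1 = {} \<longrightarrow>
              (\<exists>w\<in>W. pos_roots W \<Delta> \<inter> P = inversions W \<Delta> w)) \<and>
         (\<forall>A. A \<subseteq> pos_roots W \<Delta> \<and> finite A \<and> biclosed_roots W \<Delta> A \<longrightarrow>
              (\<exists>H P. linear_hyperplane H \<and> H \<inter> imaginary_convex_body W \<Delta> V\<^sub>1 = {} \<and>
                 open_half_space H P \<and> P \<inter> imaginary_convex_body W \<Delta> V\<^sub>1 = {} \<and>
                 A = pos_roots W \<Delta> \<inter> P))"
proof -
  interpret geometric_representation B W S \<alpha>
    by standard (use assms in auto)
  have \<Delta>: "\<Delta> = \<alpha> ` S" by (rule assms)
  obtain a where a: "a \<noteq> 0" "\<And>b. b \<in> pos_roots W \<Delta> \<Longrightarrow> 0 < a \<bullet> b"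
    and lim: "limit_roots W \<Delta> V\<^sub>1 = {x. x islimpt rescale a ` pos_roots W \<Delta>}"
    using transverse_functional assms(5) unfolding \<Delta> by blast
  show ?thesis
  proof (intro conjI allI impI; elim conjE)
    fix H P
    assume H: "H \<inter> imaginary_convex_body W \<Delta> V\<^sub>1 = {}" "open_half_space H P"
      and P: "P \<inter> imaginary_convex_body W \<Delta> V\<^sub>1 = {}"
    obtain f :: "'a \<Rightarrow> real" where f: "linear f" "H = {x. f x = 0}" "P = {x. f x > 0}"
      using H(2) by (auto simp: open_half_space_def)
    have neg: "f x < 0" if "x islimpt rescale a ` pos_roots W \<Delta>" for x
    proof -
      have "x \<in> imaginary_convex_body W \<Delta> V\<^sub>1"
        unfolding imaginary_convex_body_def lim using that by (simp add: hull_inc)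
      then have "x \<notin> H" "x \<notin> P" using H P by auto
      then show ?thesis unfolding f by simp
    qed
    have "pos_roots W \<Delta> \<inter> P = {b \<in> pos_roots W \<Delta>. 0 < f b}" unfolding f by auto
    then show "\<exists>w\<in>W. pos_roots W \<Delta> \<inter> P = inversions W \<Delta> w"
      using finite_biclosed_is_inversions[of a] biclosed_half_space[OF f(1)]
        finite_pos_roots_in_half_space[of a f] a(2) f(1) neg unfolding \<Delta> by metis
  next
    fix A
    assume "finite A" "biclosed_roots W \<Delta> A"
    then obtain w where w: "w \<in> W" "A = inversions W \<Delta> w"
      using finite_biclosed_is_inversions[of a A] a(2) unfolding \<Delta> by blast
    then obtain g where g: "g \<noteq> 0" "A = {b \<in> pos_roots W \<Delta>. g \<bullet> b < 0}"
      "\<And>x. x islimpt rescale a ` pos_roots W \<Delta> \<Longrightarrow> 0 < g \<bullet> x"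
      using inversions_half_space[of a w] a \<open>finite A\<close> unfolding \<Delta> by metis
    let ?H = "{x. - (g \<bullet> x) = 0}" and ?P = "{x. 0 < - (g \<bullet> x)}"
    have "imaginary_convex_body W \<Delta> V\<^sub>1 \<subseteq> {x. 0 < g \<bullet> x}"
      unfolding imaginary_convex_body_def lim
      by (rule hull_minimal) (use g(3) convex_halfspace_gt[of 0 g] in auto)
    then have disjoint: "?H \<inter> imaginary_convex_body W \<Delta> V\<^sub>1 = {}" "?P \<inter> imaginary_convex_body W \<Delta> V\<^sub>1 = {}"
      by fastforce+
    have hyp: "linear_hyperplane ?H"
      unfolding linear_hyperplane_def
      using dim_hyperplane[OF g(1)] subspace_hyperplane[of g] by simp
    moreover have "open_half_space ?H ?P"
      unfolding open_half_space_def
      by (intro conjI hyp exI[of _ "\<lambda>x. - (g \<bullet> x)"] refl)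
        (auto intro!: linearI simp: inner_add_right)
    moreover have "A = pos_roots W \<Delta> \<inter> ?P" using g(2) by auto
    ultimately show "\<exists>H P. linear_hyperplane H \<and> H \<inter> imaginary_convex_body W \<Delta> V\<^sub>1 = {} \<and>
        open_half_space H P \<and> P \<inter> imaginary_convex_body W \<Delta> V\<^sub>1 = {} \<and> A = pos_roots W \<Delta> \<inter> P"
      using disjoint by blast
  qed
qed

end
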